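(* Let $X_1,\dots,X_n$ be Polish spaces, $X=X_1\times\dots\times X_n$, let $G$ be a compact topological group acting continuously on each $X_k$ and diagonally on $X$, such that for every $f\in C_b(X)$ and $x\in X$ the function $G\ni g\mapsto f(g(x))$ is Borel measurable. Let $\mu_k$ be a Borel probability measure on $X_k$ invariant with respect to the action of $G$ on $X_k$, $k=1,\dots,n$, and let $c\in C_b(X)$. Let $W=\operatorname{span}\{h\circ g-h: g\in G,\ h\in C_b(X)\}$. Then $$\inf_{\pi\in\Pi_W(\mu)}\int_X c\,d\pi=\sup_{f\in F,\ f\le\bar c}\ \sum_{k=1}^n\int_{X_k}f_k\,d\mu_k=\sup_{f\in F,\ \bar f\le\bar c}\ \sum_{k=1}^n\int_{X_k}f_k\,d\mu_k ,$$ where $F=\bigoplus_{k=1}^n C_b(X_k)$ is the set of functions on $X$ of the form $f(x)=\sum_{k=1}^n f_k(x_k)$ with $f_k\in C_b(X_k)$, and inequalities between functions are pointwise on $X$.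
   Context: $C_b$ denotes bounded continuous real-valued functions. The action of $G$ on $X_k$ is written $x_k\mapsto g_k(x_k)$ (each such map is continuous), and the diagonal action on $X$ is $g(x_1,\dots,x_n)=(g_1(x_1),\dots,g_n(x_n))$. $\Pi(\mu)$ is the set of Borel probability measures on $X$ with marginals $\mu_1,\dots,\mu_n$, and $\Pi_W(\mu)=\{\pi\in\Pi(\mu):\int_X w\,d\pi=0\ \text{for all } w\in W\}$. $\chi$ is the left-invariant probability Haar measure on $G$, and for $h\in C_b(X)$, $\bar h(x)=\int_G h(g(x))\,d\chi(g)$, which is again in $C_b(X)$. *)

theory Defs
  imports
    "HOL-Probability.Probability"
    "HOL-Algebra.Group_Action"
    "HOL-Library.Function_Algebras"
begin

text \<open>
  A number n of possibly different spaces occurs in one statement, so spaces are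
  represented by abstract topologies \<^term>\<open>X k\<close> on subsets of one (arbitrary) type.  A function
  on a space is a total HOL function; only its values on the carrier matter.
\<close>

definition Polish_space :: "'a topology \<Rightarrow> bool" where
  "Polish_space X \<longleftrightarrow> completely_metrizable_space X \<and> separable_space X"

definition borel_of :: "'a topology \<Rightarrow> 'a measure" where
  "borel_of X = sigma (topspace X) {U. openin X U}"

definition borel_prob :: "'a topology \<Rightarrow> 'a measure \<Rightarrow> bool" where
  "borel_prob X M \<longleftrightarrow> prob_space M \<and> sets M = sets (borel_of X)"

definition Cb :: "'a topology \<Rightarrow> ('a \<Rightarrow> real) set" where
  "Cb X = {f. continuous_map X euclideanreal f \<and> bounded (f ` topspace X)}"

abbreviation product_space :: "nat \<Rightarrow> (nat \<Rightarrow> 'a topology) \<Rightarrow> (nat \<Rightarrow> 'a) topology" where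
  "product_space n X \<equiv> product_topology X {1..n}"

definition topological_group :: "('g, 'e) monoid_scheme \<Rightarrow> 'g topology \<Rightarrow> bool" where
  "topological_group G T \<longleftrightarrow> group G \<and> topspace T = carrier G \<and>
     continuous_map (prod_topology T T) T (\<lambda>(x, y). x \<otimes>\<^bsub>G\<^esub> y) \<and>
     continuous_map T T (\<lambda>x. inv\<^bsub>G\<^esub> x)"

text \<open>
  A Haar measure is by convention a Radon measure, which for a probability measure means the
  two regularity conditions below.  Uniqueness of the left-invariant probability measure on a
  compact group that is not second countable depends on them.
\<close>

definition Haar_prob :: "('g, 'e) monoid_scheme \<Rightarrow> 'g topology \<Rightarrow> 'g measure \<Rightarrow> bool" where
  "Haar_prob G T \<eta> \<longleftrightarrow> borel_prob T \<eta> \<and>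
     (\<forall>A\<in>sets \<eta>. emeasure \<eta> A = (INF U\<in>{U. openin T U \<and> A \<subseteq> U}. emeasure \<eta> U)) \<and>
     (\<forall>U. openin T U \<longrightarrow> emeasure \<eta> U = (SUP K\<in>{K. compactin T K \<and> K \<subseteq> U}. emeasure \<eta> K)) \<and>
     (\<forall>g\<in>carrier G. distr \<eta> \<eta> (\<lambda>h. g \<otimes>\<^bsub>G\<^esub> h) = \<eta>)"

definition diag_act :: "nat \<Rightarrow> (nat \<Rightarrow> 'g \<Rightarrow> 'a \<Rightarrow> 'a) \<Rightarrow> 'g \<Rightarrow> (nat \<Rightarrow> 'a) \<Rightarrow> (nat \<Rightarrow> 'a)" where
  "diag_act n a g x = (\<lambda>k\<in>{1..n}. a k g (x k))"

definition avg :: "'g measure \<Rightarrow> ('g \<Rightarrow> 'x \<Rightarrow> 'x) \<Rightarrow> ('x \<Rightarrow> real) \<Rightarrow> 'x \<Rightarrow> real" where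
  "avg \<eta> act h x = (\<integral>g. h (act g x) \<partial>\<eta>)"

definition couplings :: "nat \<Rightarrow> (nat \<Rightarrow> 'a topology) \<Rightarrow> (nat \<Rightarrow> 'a measure) \<Rightarrow> (nat \<Rightarrow> 'a) measure set" where
  "couplings n X \<mu> = {\<pi>. borel_prob (product_space n X) \<pi> \<and>
     (\<forall>k\<in>{1..n}. distr \<pi> (borel_of (X k)) (\<lambda>x. x k) = \<mu> k)}"

definition W_couplings :: "nat \<Rightarrow> (nat \<Rightarrow> 'a topology) \<Rightarrow> (nat \<Rightarrow> 'a measure) \<Rightarrow>
    ((nat \<Rightarrow> 'a) \<Rightarrow> real) set \<Rightarrow> (nat \<Rightarrow> 'a) measure set" where
  "W_couplings n X \<mu> W = {\<pi> \<in> couplings n X \<mu>. \<forall>w\<in>W. (\<integral>x. w x \<partial>\<pi>) = 0}"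

text \<open>The linear span in the real vector space of real functions on \<^typ>\<open>'x\<close>.\<close>

definition fun_span :: "('x \<Rightarrow> real) set \<Rightarrow> ('x \<Rightarrow> real) set" where
  "fun_span = module.span (\<lambda>r f x. r * f x)"

definition W_inv :: "'g set \<Rightarrow> 'x topology \<Rightarrow> ('g \<Rightarrow> 'x \<Rightarrow> 'x) \<Rightarrow> ('x \<Rightarrow> real) set" where
  "W_inv S Y act = fun_span {(\<lambda>x. h (act g x) - h x) | g h. g \<in> S \<and> h \<in> Cb Y}"

definition oplus :: "nat \<Rightarrow> (nat \<Rightarrow> 'a \<Rightarrow> real) \<Rightarrow> (nat \<Rightarrow> 'a) \<Rightarrow> real" where
  "oplus n f x = (\<Sum>k=1..n. f k (x k))"

text \<open>
  The elements of F are the functions \<^term>\<open>oplus n f\<close> with f in the following set.  A supremum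
  over F is taken over the tuples f, since its objective is written in terms of the summands.
\<close>

definition F_tuples :: "nat \<Rightarrow> (nat \<Rightarrow> 'a topology) \<Rightarrow> (nat \<Rightarrow> 'a \<Rightarrow> real) set" where
  "F_tuples n X = {f. \<forall>k\<in>{1..n}. f k \<in> Cb (X k)}"

end

theory Submission
  imports Defs
begin

text \<open>
  Averaging a coupling over the group yields a coupling that annihilates W, and the integral of c
  with respect to it is the integral of the average of c with respect to the original coupling;
  conversely, a coupling that annihilates W gives the same integral to c and to its average.  Hence
  the left-hand side is the Kantorovich problem with the continuous cost given by the average of c.
  Since averaging is idempotent, averaging both sides of a constraint gives the second equality.

  Kantorovich duality is reduced to a finite transport problem.  All but a small part of each
  marginal lives on a compact set, which is cut into small cells.  For the finite problem, the
  value of the dual problem is a sublinear functional of the cost; it is made linear in one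
  direction after the other, and the linear functional that results is an optimal discrete
  coupling.  This coupling is realized by a density with respect to the product measure, and
  discrete potentials u are turned into Lipschitz ones by taking the supremum of u(y) - m d(x, y)
  over y.
\<close>

section \<open>Borel sets of abstract topological spaces\<close>

text \<open>Three obstacles shape the proof. The action is only known to be continuous in x for
  fixed g, and measurable in g when tested against one function of \<open>Cb\<close> at one point.
  Fubini over group and space needs joint measurability, which has to be derived from these two
  facts. Averaging is with respect to a left-invariant measure. What left invariance gives directly
  is that h composed with the action of g has the same average as h; invariance of the average of h
  as a function is not what is used. In the transport problem, tightness makes the mass off a
  compact set small, which is enough for integrals but not for the dual constraint: that must hold
  at every point, also where the cost has no uniform modulus of continuity. Hence the discretized
  cost is penalized by distance, and the same slope is used for the potentials. Only values are
  compared, so a coupling and potentials whose values differ by at most \<epsilon> suffice. Both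
  come from one finite problem; no minimizer and no limit of couplings or potentials is
  needed.\<close>

lemma space_borel_of [simp]: "space (borel_of X) = topspace X"
  unfolding borel_of_def by (rule space_measure_of) (auto dest: openin_subset)

lemma sets_borel_of: "sets (borel_of X) = sigma_sets (topspace X) {U. openin X U}"
  unfolding borel_of_def by (rule sets_measure_of) (auto dest: openin_subset)

lemma openin_sets_borel_of: "openin X U \<Longrightarrow> U \<in> sets (borel_of X)"
  by (simp add: sets_borel_of sigma_sets.Basic)

lemma closedin_sets_borel_of:
  assumes "closedin X C" shows "C \<in> sets (borel_of X)"
proof -
  have "C = space (borel_of X) - (topspace X - C)"
    using closedin_subset[OF assms] by auto
  also have "\<dots> \<in> sets (borel_of X)"
    by (intro sets.compl_sets openin_sets_borel_of) (use assms closedin_def in blast)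
  finally show ?thesis .
qed

lemma measurable_into_borel_of:
  assumes "\<And>x. x \<in> space N \<Longrightarrow> f x \<in> topspace Y"
    and "\<And>U. openin Y U \<Longrightarrow> f -` U \<inter> space N \<in> sets N"
  shows "f \<in> measurable N (borel_of Y)"
  unfolding borel_of_def
  by (rule measurable_measure_of) (use assms in \<open>auto dest: openin_subset\<close>)

lemma continuous_map_measurable:
  assumes "continuous_map X Y f"
  shows "f \<in> measurable (borel_of X) (borel_of Y)"
proof (rule measurable_into_borel_of)
  show "f x \<in> topspace Y" if "x \<in> space (borel_of X)" for x
    using that assms by (auto simp: continuous_map_def)
  show "f -` U \<inter> space (borel_of X) \<in> sets (borel_of X)" if U: "openin Y U" for U
  proof -
    have "f -` U \<inter> space (borel_of X) = {x \<in> topspace X. f x \<in> U}"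
      by auto
    then show ?thesis
      using assms U by (simp add: continuous_map_def openin_sets_borel_of)
  qed
qed

lemma borel_of_euclidean: "borel_of euclidean = borel"
  by (simp add: borel_of_def borel_def)

lemma continuous_map_borel_measurable:
  "continuous_map X euclideanreal f \<Longrightarrow> f \<in> borel_measurable (borel_of X)"
  using continuous_map_measurable[of X euclideanreal f] by (simp add: borel_of_euclidean)

lemma Cb_borel_measurable: "f \<in> Cb X \<Longrightarrow> f \<in> borel_measurable (borel_of X)"
  by (simp add: Cb_def continuous_map_borel_measurable)

lemma Cb_bound:
  assumes "f \<in> Cb X"
  obtains B where "0 \<le> B" "\<And>x. x \<in> topspace X \<Longrightarrow> \<bar>f x\<bar> \<le> B"
proof -
  obtain B where "\<And>x. x \<in> topspace X \<Longrightarrow> \<bar>f x\<bar> \<le> B"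
    using assms by (auto simp: Cb_def bounded_iff)
  then show ?thesis
    using that[of "\<bar>B\<bar>"] by force
qed

lemma Cb_integrable:
  assumes "f \<in> Cb X" "borel_prob X M"
  shows "integrable M f"
proof -
  interpret prob_space M using assms by (simp add: borel_prob_def)
  have s: "sets M = sets (borel_of X)" using assms by (simp add: borel_prob_def)
  obtain B where B: "\<And>x. x \<in> topspace X \<Longrightarrow> \<bar>f x\<bar> \<le> B"
    using Cb_bound[OF assms(1)] by blast
  show ?thesis
  proof (rule integrable_const_bound)
    show "AE x in M. norm (f x) \<le> B"
      using B sets_eq_imp_space_eq[OF s] by (auto intro!: AE_I2)
    show "f \<in> borel_measurable M"
      using Cb_borel_measurable[OF assms(1)] measurable_cong_sets[OF s refl] by blast
  qed
qed

lemma Cb_compose: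
  assumes "f \<in> Cb Y" "continuous_map X Y g"
  shows "(\<lambda>x. f (g x)) \<in> Cb X"
proof -
  have "continuous_map X euclideanreal (f \<circ> g)"
    using assms by (intro continuous_map_compose) (auto simp: Cb_def)
  moreover have "bounded ((f \<circ> g) ` topspace X)"
    using assms by (auto simp: Cb_def continuous_map_def image_comp[symmetric] intro: bounded_subset)
  ultimately show ?thesis
    by (simp add: Cb_def o_def)
qed

section \<open>Second countability and the Borel sets of finite products\<close>

lemma (in Metric_space) second_countable_mtopology:
  assumes "separable_space mtopology"
  shows "second_countable mtopology"
proof -
  obtain D where D: "countable D" "D \<subseteq> M" "mtopology closure_of D = M"
    using assms by (auto simp: separable_space_def)
  define \<B> where "\<B> = (\<lambda>(x, n). mball x (inverse (Suc n))) ` (D \<times> (UNIV :: nat set))"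
  show ?thesis
    unfolding second_countable_def
  proof (intro exI[of _ \<B>] conjI allI impI)
    show "countable \<B>" unfolding \<B>_def using D by auto
    show "\<forall>V\<in>\<B>. openin mtopology V" by (auto simp: \<B>_def)
    fix U x assume Ux: "openin mtopology U \<and> x \<in> U"
    then obtain r where r: "r > 0" "mball x r \<subseteq> U" and xM: "x \<in> M"
      by (meson openin_mtopology subsetD)
    obtain n where n: "inverse (real (Suc n)) < r / 2"
      using reals_Archimedean[of "r/2"] r by auto
    obtain y where y: "y \<in> D" "d x y < inverse (real (Suc n))"
      using D(3) xM unfolding metric_closure_of
      by (smt (verit, ccfv_SIG) in_mball inverse_positive_iff_positive mem_Collect_eq of_nat_0_less_iff zero_less_Suc)
    show "\<exists>V\<in>\<B>. x \<in> V \<and> V \<subseteq> U"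
    proof (intro bexI conjI)
      show "mball y (inverse (real (Suc n))) \<in> \<B>"
        unfolding \<B>_def by (rule image_eqI[of _ _ "(y, n)"]) (use y in auto)
      show "x \<in> mball y (inverse (real (Suc n)))"
        using y D xM by (auto simp: commute)
      have "mball y (inverse (real (Suc n))) \<subseteq> mball x r"
        by (rule mball_subset) (use y n xM in \<open>auto simp: commute\<close>)
      then show "mball y (inverse (real (Suc n))) \<subseteq> U" using r by auto
    qed
  qed
qed

lemma Polish_space_second_countable: "Polish_space X \<Longrightarrow> second_countable X"
  unfolding Polish_space_def
  by (metis Metric_space.second_countable_mtopology completely_metrizable_imp_metrizable_space
      metrizable_space_def)

text \<open>The base has to consist of boxes, not just be countable: then every open set of the
  product is a countable union of sets that the product \<sigma>-algebra visibly contains. The boxes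
  are formed from countable bases of the factors, and finiteness of \<open>I\<close> keeps them open
  and countable in number.\<close>

lemma product_topology_countable_box_base:
  assumes I: "finite I" and X: "\<And>i. i \<in> I \<Longrightarrow> second_countable (X i)"
  shows "\<exists>\<B>. countable \<B> \<and> (\<forall>V\<in>\<B>. \<exists>B. V = Pi\<^sub>E I B \<and> (\<forall>i\<in>I. openin (X i) (B i))) \<and>
    (\<forall>U x. openin (product_topology X I) U \<and> x \<in> U \<longrightarrow> (\<exists>V\<in>\<B>. x \<in> V \<and> V \<subseteq> U))"
proof -
  have "\<forall>i\<in>I. \<exists>\<A>. countable \<A> \<and> (\<forall>V \<in> \<A>. openin (X i) V) \<and>
             (\<forall>U x. openin (X i) U \<and> x \<in> U \<longrightarrow> (\<exists>V \<in> \<A>. x \<in> V \<and> V \<subseteq> U))"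
    using X by (simp add: second_countable_def)
  then obtain \<A> where \<A>: "\<And>i. i \<in> I \<Longrightarrow> countable (\<A> i)"
    "\<And>i V. i \<in> I \<Longrightarrow> V \<in> \<A> i \<Longrightarrow> openin (X i) V"
    "\<And>i U x. i \<in> I \<Longrightarrow> openin (X i) U \<Longrightarrow> x \<in> U \<Longrightarrow> \<exists>V \<in> \<A> i. x \<in> V \<and> V \<subseteq> U"
    by (metis (no_types, lifting))
  define \<B> where "\<B> = Pi\<^sub>E I ` (Pi\<^sub>E I \<A>)"
  show ?thesis
  proof (intro exI[of _ \<B>] conjI allI impI ballI)
    show "countable \<B>"
      unfolding \<B>_def using \<A>(1) I by (intro countable_image countable_PiE) auto
    show "\<exists>B. V = Pi\<^sub>E I B \<and> (\<forall>i\<in>I. openin (X i) (B i))" if "V \<in> \<B>" for V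
      using that \<A>(2) by (auto simp: \<B>_def PiE_iff)
    fix U x assume "openin (product_topology X I) U \<and> x \<in> U"
    then have U: "openin (product_topology X I) U" and x: "x \<in> U" by auto
    then obtain W where W: "x \<in> Pi\<^sub>E I W" "\<And>i. openin (X i) (W i)" "Pi\<^sub>E I W \<subseteq> U"
      using product_topology_open_contains_basis[OF U x] by auto
    have "\<forall>i\<in>I. \<exists>V \<in> \<A> i. x i \<in> V \<and> V \<subseteq> W i"
      using \<A>(3) W by (auto simp: PiE_iff)
    then obtain B where B: "\<And>i. i \<in> I \<Longrightarrow> B i \<in> \<A> i \<and> x i \<in> B i \<and> B i \<subseteq> W i"
      by metis
    show "\<exists>V\<in>\<B>. x \<in> V \<and> V \<subseteq> U"
    proof (intro bexI conjI)
      show "Pi\<^sub>E I B \<in> \<B>"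
        unfolding \<B>_def
        by (rule image_eqI[of _ _ "restrict B I"]) (use B in \<open>auto cong: PiE_cong\<close>)
      show "x \<in> Pi\<^sub>E I B" using B W by (auto simp: PiE_iff)
      show "Pi\<^sub>E I B \<subseteq> U" using B W(3) PiE_mono[of I B W] by blast
    qed
  qed
qed

lemma second_countable_product_topology:
  assumes "finite I" "\<And>i. i \<in> I \<Longrightarrow> second_countable (X i)"
  shows "second_countable (product_topology X I)"
proof -
  obtain \<B> where "countable \<B>"
    "\<And>V. V \<in> \<B> \<Longrightarrow> \<exists>B. V = Pi\<^sub>E I B \<and> (\<forall>i\<in>I. openin (X i) (B i))"
    "\<And>U x. openin (product_topology X I) U \<Longrightarrow> x \<in> U \<Longrightarrow> \<exists>V\<in>\<B>. x \<in> V \<and> V \<subseteq> U"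
    using product_topology_countable_box_base[of I X, OF assms] by metis
  moreover have "openin (product_topology X I) V" if "V \<in> \<B>" for V
    using calculation(2)[OF that] openin_PiE[OF assms(1), of X] by metis
  ultimately show ?thesis
    unfolding second_countable_def by (intro exI[of _ \<B>]) simp
qed

text \<open>Couplings are built as densities on \<open>PiM\<close>, whereas
  \<open>borel_prob\<close> refers to the product topology; this identity passes between the two.
  The inclusion from right to left is where second countability enters.\<close>

lemma sets_PiM_borel_of:
  assumes I: "finite I" and X: "\<And>i. i \<in> I \<Longrightarrow> second_countable (X i)"
  shows "sets (PiM I (\<lambda>i. borel_of (X i))) = sets (borel_of (product_topology X I))"
proof
  show "sets (PiM I (\<lambda>i. borel_of (X i))) \<subseteq> sets (borel_of (product_topology X I))"
  proof (rule sets_PiM_in_sets)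
    show "space (borel_of (product_topology X I)) = (\<Pi>\<^sub>E i\<in>I. space (borel_of (X i)))"
      by simp
    fix i A assume i: "i \<in> I" and A: "A \<in> sets (borel_of (X i))"
    have "(\<lambda>x. x i) \<in> measurable (borel_of (product_topology X I)) (borel_of (X i))"
      by (intro continuous_map_measurable continuous_map_product_projection i)
    then have "(\<lambda>x. x i) -` A \<inter> space (borel_of (product_topology X I))
        \<in> sets (borel_of (product_topology X I))"
      using A measurable_sets by blast
    also have "(\<lambda>x. x i) -` A \<inter> space (borel_of (product_topology X I))
        = {x \<in> space (borel_of (product_topology X I)). x i \<in> A}" by auto
    finally show "{x \<in> space (borel_of (product_topology X I)). x i \<in> A}
        \<in> sets (borel_of (product_topology X I))" .
  qed
next
  obtain \<B> where \<B>: "countable \<B>"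
    "\<And>V. V \<in> \<B> \<Longrightarrow> \<exists>B. V = Pi\<^sub>E I B \<and> (\<forall>i\<in>I. openin (X i) (B i))"
    "\<And>U x. openin (product_topology X I) U \<Longrightarrow> x \<in> U \<Longrightarrow> \<exists>V\<in>\<B>. x \<in> V \<and> V \<subseteq> U"
    using product_topology_countable_box_base[of I X, OF assms] by metis
  let ?P = "PiM I (\<lambda>i. borel_of (X i))"
  have "U \<in> sets ?P" if U: "openin (product_topology X I) U" for U
  proof -
    have "U = \<Union>{V \<in> \<B>. V \<subseteq> U}" using \<B>(3)[OF U] by blast
    moreover have "V \<in> sets ?P" if "V \<in> \<B>" for V
      using \<B>(2)[OF that] I by (auto intro!: sets_PiM_I_finite openin_sets_borel_of)
    ultimately show ?thesis
      using \<B>(1) sets.countable_Union[of "{V \<in> \<B>. V \<subseteq> U}" ?P] by auto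
  qed
  then have "sigma_sets (space ?P) {U. openin (product_topology X I) U} \<subseteq> sets ?P"
    by (intro sets.sigma_sets_subset) auto
  moreover have "topspace (product_topology X I) = space ?P" by (simp add: space_PiM)
  ultimately show "sets (borel_of (product_topology X I)) \<subseteq> sets ?P"
    by (simp only: sets_borel_of)
qed

section \<open>Lipschitz envelopes and joint measurability\<close>

lemma (in Metric_space) continuous_map_sequentially:
  fixes f :: "'a \<Rightarrow> real"
  assumes "\<And>\<sigma> l. range \<sigma> \<subseteq> M \<Longrightarrow> limitin mtopology \<sigma> l sequentially \<Longrightarrow> (\<lambda>n. f (\<sigma> n)) \<longlonglongrightarrow> f l"
  shows "continuous_map mtopology euclideanreal f"
  unfolding continuous_map_closedin
proof (intro conjI allI impI)
  show "f \<in> topspace mtopology \<rightarrow> topspace euclideanreal" by simp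
  fix C :: "real set" assume "closedin euclideanreal C"
  then have C: "closed C" by simp
  show "closedin mtopology {x \<in> topspace mtopology. f x \<in> C}"
    unfolding metric_closedin_iff_sequentially_closed
  proof (intro conjI allI impI)
    show "{x \<in> topspace mtopology. f x \<in> C} \<subseteq> M" by auto
    fix \<sigma> l assume *: "range \<sigma> \<subseteq> {x \<in> topspace mtopology. f x \<in> C} \<and> limitin mtopology \<sigma> l sequentially"
    then have lim: "(\<lambda>n. f (\<sigma> n)) \<longlonglongrightarrow> f l" by (intro assms) auto
    have "f (\<sigma> n) \<in> C" for n using * by auto
    then have "f l \<in> C" using lim by (rule closed_sequentially[OF C])
    moreover have "l \<in> M" using * limitin_mspace by blast
    ultimately show "l \<in> {x \<in> topspace mtopology. f x \<in> C}" by simp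
  qed
qed

lemma (in Metric_space) lipschitz_continuous_map:
  fixes f :: "'a \<Rightarrow> real"
  assumes "\<And>x y. x \<in> M \<Longrightarrow> y \<in> M \<Longrightarrow> f x \<le> f y + L * d x y"
  shows "continuous_map mtopology euclideanreal f"
proof (rule continuous_map_sequentially)
  fix \<sigma> l assume \<sigma>: "range \<sigma> \<subseteq> M" and lim: "limitin mtopology \<sigma> l sequentially"
  then have l: "l \<in> M" and d0: "(\<lambda>n. d (\<sigma> n) l) \<longlonglongrightarrow> 0"
    by (auto simp: limitin_metric_dist_null)
  have "norm (f (\<sigma> n) - f l) \<le> L * d (\<sigma> n) l" for n
  proof -
    have "\<sigma> n \<in> M" using \<sigma> by blast
    then show ?thesis
      using assms[of "\<sigma> n" l] assms[of l "\<sigma> n"] l commute[of l "\<sigma> n"] by simp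
  qed
  moreover have "(\<lambda>n. L * d (\<sigma> n) l) \<longlonglongrightarrow> 0"
    using tendsto_mult_right_zero[OF d0] by simp
  ultimately have "(\<lambda>n. f (\<sigma> n) - f l) \<longlonglongrightarrow> 0"
    by (intro Lim_null_comparison[of "\<lambda>n. f (\<sigma> n) - f l" "\<lambda>n. L * d (\<sigma> n) l"] always_eventually allI)
  then show "(\<lambda>n. f (\<sigma> n)) \<longlonglongrightarrow> f l" by (simp add: LIM_zero_iff)
qed

lemma (in Metric_space) lipschitz_envelope:
  fixes v :: "'a \<Rightarrow> real"
  assumes v: "\<forall>y\<in>M. \<bar>v y\<bar> \<le> B" and L: "0 \<le> L"
    and f: "\<And>x. f x = (SUP y\<in>M. v y - L * d x y)"
  shows "f \<in> Cb mtopology"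
    and "\<And>x. x \<in> M \<Longrightarrow> v x \<le> f x"
    and "\<And>x y. x \<in> M \<Longrightarrow> y \<in> M \<Longrightarrow> v y - L * d x y \<le> f x"
    and "\<And>x a. x \<in> M \<Longrightarrow> (\<And>y. y \<in> M \<Longrightarrow> v y - L * d x y \<le> a) \<Longrightarrow> f x \<le> a"
proof -
  have le: "v y - L * d x y \<le> B" if "y \<in> M" for x y
  proof -
    have "0 \<le> L * d x y" using L by simp
    then show ?thesis using v[rule_format, OF that] by linarith
  qed
  show ge: "v y - L * d x y \<le> f x" if "x \<in> M" "y \<in> M" for x y
    unfolding f using le that by (intro cSUP_upper bdd_aboveI[of _ B]) auto
  show least: "f x \<le> a" if "x \<in> M" "\<And>y. y \<in> M \<Longrightarrow> v y - L * d x y \<le> a" for x a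
    unfolding f using that by (intro cSUP_least) auto
  show gev: "v x \<le> f x" if "x \<in> M" for x using ge[OF that that] that by simp
  have "f x \<le> f y + L * d x y" if xy: "x \<in> M" "y \<in> M" for x y
  proof (rule least[OF xy(1)])
    fix z assume z: "z \<in> M"
    have "L * d y z \<le> L * (d x y + d x z)"
      using L triangle[of y x z] xy z by (intro mult_left_mono) (auto simp: commute)
    then show "v z - L * d x z \<le> f y + L * d x y"
      using ge[OF xy(2) z] by (simp add: algebra_simps)
  qed
  then have "continuous_map mtopology euclideanreal f" by (rule lipschitz_continuous_map)
  moreover have "bounded (f ` M)"
  proof (rule boundedI)
    fix z assume "z \<in> f ` M"
    then obtain x where x: "x \<in> M" "z = f x" by auto
    have "f x \<le> B" by (rule least[OF x(1)]) (use le in auto)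
    then show "norm z \<le> B" using gev[OF x(1)] v[rule_format, OF x(1)] x(2) by auto
  qed
  ultimately show "f \<in> Cb mtopology" by (simp add: Cb_def)
qed

text \<open>The envelope of minus the indicator of \<open>U\<close> is minus the distance to the
  complement of \<open>U\<close>, cut off at 1. With such an \<open>f\<close>, measurability of
  preimages of open sets reduces to measurability of real functions obtained from
  \<open>Cb\<close>.\<close>

lemma openin_cozero_set:
  assumes "metrizable_space Y" "openin Y U"
  obtains f where "f \<in> Cb Y" "\<And>x. x \<in> topspace Y \<Longrightarrow> x \<in> U \<longleftrightarrow> f x < 0"
proof -
  obtain M d where "Metric_space M d" and Y: "Y = Metric_space.mtopology M d"
    using assms(1) by (auto simp: metrizable_space_def)
  interpret Metric_space M d by fact
  define v :: "'a \<Rightarrow> real" where "v = (\<lambda>y. if y \<in> U then -1 else 0)"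
  define f where "f = (\<lambda>x. SUP y\<in>M. v y - 1 * d x y)"
  have v: "\<forall>y\<in>M. \<bar>v y\<bar> \<le> 1" by (simp add: v_def)
  note env = lipschitz_envelope[of v 1 1 f, OF v zero_le_one f_def[THEN fun_cong]]
  show ?thesis
  proof (rule that[of f])
    show "f \<in> Cb Y" using env(1) unfolding Y .
    fix x assume "x \<in> topspace Y"
    then have x: "x \<in> M" using Y by simp
    show "x \<in> U \<longleftrightarrow> f x < 0"
    proof
      assume xU: "x \<in> U"
      obtain r where r: "r > 0" "mball x r \<subseteq> U"
        using assms(2) xU unfolding Y openin_mtopology by blast
      have "f x \<le> - min 1 r"
      proof (rule env(4)[OF x])
        fix y assume y: "y \<in> M"
        show "v y - 1 * d x y \<le> - min 1 r"
        proof (cases "d x y < r")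
          case True
          then have "y \<in> mball x r" using x y by simp
          then have "y \<in> U" using r by blast
          then have "v y = -1" by (simp add: v_def)
          then show ?thesis using nonneg[of x y] min.cobounded1[of 1 r] by linarith
        next
          case False
          moreover have "v y \<le> 0" by (simp add: v_def)
          ultimately show ?thesis using min.cobounded2[of 1 r] by linarith
        qed
      qed
      then show "f x < 0" using r by auto
    next
      assume "f x < 0"
      then show "x \<in> U" using env(2)[OF x] by (auto simp: v_def split: if_splits)
    qed
  qed
qed

text \<open>Caratheodory functions: \<^term>\<open>F g x\<close> is the limit of \<^term>\<open>F g y\<close>, with y the first point
  of a dense sequence within distance \<^term>\<open>inverse (Suc m)\<close> of x, as m tends to infinity.\<close>

lemma caratheodory_measurable:
  fixes F :: "'g \<Rightarrow> 'x \<Rightarrow> real"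
  assumes Y: "metrizable_space Y" "separable_space Y"
    and meas: "\<And>x. x \<in> topspace Y \<Longrightarrow> (\<lambda>g. F g x) \<in> borel_measurable N"
    and cont: "\<And>g. g \<in> space N \<Longrightarrow> continuous_map Y euclideanreal (F g)"
  shows "(\<lambda>(g, x). F g x) \<in> borel_measurable (N \<Otimes>\<^sub>M borel_of Y)"
proof (cases "topspace Y = {}")
  case True
  then have "space (N \<Otimes>\<^sub>M borel_of Y) = {}" by (simp add: space_pair_measure)
  then show ?thesis by (intro measurableI) auto
next
  case False
  obtain M d where "Metric_space M d" and Yd: "Y = Metric_space.mtopology M d"
    using Y(1) by (auto simp: metrizable_space_def)
  interpret Metric_space M d by fact
  have top: "topspace Y = M" using Yd by simp
  obtain D where D: "countable D" "D \<subseteq> M" "(mtopology closure_of D) = M"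
    using Y(2) by (auto simp: separable_space_def Yd)
  have "D \<noteq> {}" using D False top by auto
  then obtain e :: "nat \<Rightarrow> 'x" where e: "range e = D"
    using D(1) range_from_nat_into by metis
  have eM: "e j \<in> M" for j using e D by auto
  define J where "J = (\<lambda>m x. LEAST j. d x (e j) < inverse (real (Suc m)))"
  have ex: "\<exists>j. d x (e j) < inverse (real (Suc m))" if "x \<in> M" for x m
  proof -
    have "x \<in> mtopology closure_of D" using D that by simp
    moreover have "0 < inverse (real (Suc m))" by simp
    ultimately obtain y where "y \<in> D" "y \<in> mball x (inverse (real (Suc m)))"
      unfolding metric_closure_of by blast
    then show ?thesis using e by auto
  qed
  have J: "d x (e (J m x)) < inverse (real (Suc m))" if "x \<in> M" for x m
    unfolding J_def using ex[OF that] by (rule LeastI_ex)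
  have dm: "{x \<in> M. d x (e j) < r} \<in> sets (borel_of Y)" for j r
  proof -
    have "{x \<in> M. d x (e j) < r} = mball (e j) r" using eM by (auto simp: commute)
    then show ?thesis using openin_mball by (simp add: Yd openin_sets_borel_of)
  qed
  have "(\<lambda>x. d x (e j) < r) \<in> measurable (borel_of Y) (count_space UNIV)" for j r
    using dm[of j r] by (intro pred_def[THEN iffD2]) (simp add: top)
  then have Jm: "J m \<in> measurable (borel_of Y) (count_space UNIV)" for m
    unfolding J_def by (intro measurable_Least) auto
  have *: "(\<lambda>p. F (fst p) (e (J m (snd p)))) \<in> borel_measurable (N \<Otimes>\<^sub>M borel_of Y)" for m
  proof (rule measurable_compose_countable[where f = "\<lambda>j p. F (fst p) (e j)"])
    show "(\<lambda>p. F (fst p) (e j)) \<in> borel_measurable (N \<Otimes>\<^sub>M borel_of Y)" for j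
      by (rule measurable_compose[OF measurable_fst meas]) (simp add: eM top)
    show "(\<lambda>p. J m (snd p)) \<in> measurable (N \<Otimes>\<^sub>M borel_of Y) (count_space UNIV)"
      by (rule measurable_compose[OF measurable_snd Jm])
  qed
  show ?thesis
  proof (rule borel_measurable_LIMSEQ_metric[OF *])
    fix p assume "p \<in> space (N \<Otimes>\<^sub>M borel_of Y)"
    then obtain g x where p: "p = (g, x)" "g \<in> space N" "x \<in> M"
      by (auto simp: space_pair_measure top)
    have "(\<lambda>m. d (e (J m x)) x) \<longlonglongrightarrow> 0"
    proof (rule tendsto_sandwich[OF _ _ tendsto_const LIMSEQ_inverse_real_of_nat])
      show "\<forall>\<^sub>F m in sequentially. d (e (J m x)) x \<le> inverse (real (Suc m))"
        using J[OF p(3)] by (intro always_eventually allI less_imp_le) (simp add: commute)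
    qed simp
    then have "limitin mtopology (\<lambda>m. e (J m x)) x sequentially"
      using eM p by (simp add: limitin_metric_dist_null)
    then have "limitin euclideanreal (F g \<circ> (\<lambda>m. e (J m x))) (F g x) sequentially"
      by (rule continuous_map_limit[OF cont[OF p(2), unfolded Yd]])
    then show "(\<lambda>m. F (fst p) (e (J m (snd p)))) \<longlonglongrightarrow> (case p of (g, x) \<Rightarrow> F g x)"
      using p by (simp add: o_def)
  qed
qed

section \<open>Averaging over a group\<close>

text \<open>What averaging uses of the diagonal action: the group enters only through its carrier,
  its multiplication and a left-invariant probability measure. Measurability in g is stated
  pointwise in x, as in the theorem; joint measurability is derived inside the locale.\<close>

locale averaging_action = prob_space \<eta>
  for Y :: "'x topology" and G :: "('g, 'e) monoid_scheme" and \<eta> :: "'g measure"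
    and act :: "'g \<Rightarrow> 'x \<Rightarrow> 'x" +
  assumes metrizable: "metrizable_space Y" and separable: "separable_space Y"
    and space_eta: "space \<eta> = carrier G"
    and act_continuous: "g \<in> carrier G \<Longrightarrow> continuous_map Y Y (act g)"
    and act_mult: "g \<in> carrier G \<Longrightarrow> h \<in> carrier G \<Longrightarrow> x \<in> topspace Y \<Longrightarrow>
      act (g \<otimes>\<^bsub>G\<^esub> h) x = act g (act h x)"
    and orbit_measurable: "f \<in> Cb Y \<Longrightarrow> x \<in> topspace Y \<Longrightarrow> (\<lambda>g. f (act g x)) \<in> borel_measurable \<eta>"
    and mult_measurable: "g \<in> carrier G \<Longrightarrow> (\<lambda>h. g \<otimes>\<^bsub>G\<^esub> h) \<in> measurable \<eta> \<eta>"
    and left_invariant: "g \<in> carrier G \<Longrightarrow> distr \<eta> \<eta> (\<lambda>h. g \<otimes>\<^bsub>G\<^esub> h) = \<eta>"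
begin

lemma act_in: "g \<in> carrier G \<Longrightarrow> x \<in> topspace Y \<Longrightarrow> act g x \<in> topspace Y"
  using act_continuous[of g] by (auto simp: continuous_map_def)

lemma act_Cb: "h \<in> Cb Y \<Longrightarrow> g \<in> carrier G \<Longrightarrow> (\<lambda>x. h (act g x)) \<in> Cb Y"
  using Cb_compose[OF _ act_continuous[of g], of h] by simp

text \<open>For \<open>f\<close> in \<open>Cb Y\<close> the function \<open>f (act g x)\<close> is
  measurable in g and continuous in x, hence jointly measurable as a Caratheodory function. Writing
  an open set as the set where such an \<open>f\<close> is negative transfers this to the action
  itself.\<close>

lemma act_jointly_measurable:
  "(\<lambda>(g, x). act g x) \<in> measurable (\<eta> \<Otimes>\<^sub>M borel_of Y) (borel_of Y)"
proof (rule measurable_into_borel_of)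
  show "(case p of (g, x) \<Rightarrow> act g x) \<in> topspace Y" if "p \<in> space (\<eta> \<Otimes>\<^sub>M borel_of Y)" for p
    using that act_in by (auto simp: space_pair_measure space_eta)
  fix U assume "openin Y U"
  then obtain f where f: "f \<in> Cb Y" "\<And>x. x \<in> topspace Y \<Longrightarrow> x \<in> U \<longleftrightarrow> f x < 0"
    using openin_cozero_set[OF metrizable] by metis
  have "(\<lambda>(g, x). f (act g x)) \<in> borel_measurable (\<eta> \<Otimes>\<^sub>M borel_of Y)"
    by (intro caratheodory_measurable metrizable separable orbit_measurable f)
      (use act_Cb[OF f(1)] space_eta in \<open>auto simp: Cb_def\<close>)
  then have "(\<lambda>(g, x). f (act g x)) -` {..<0} \<inter> space (\<eta> \<Otimes>\<^sub>M borel_of Y) \<in> sets (\<eta> \<Otimes>\<^sub>M borel_of Y)"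
    by (rule measurable_sets) simp
  also have "(\<lambda>(g, x). f (act g x)) -` {..<0} \<inter> space (\<eta> \<Otimes>\<^sub>M borel_of Y)
      = (\<lambda>(g, x). act g x) -` U \<inter> space (\<eta> \<Otimes>\<^sub>M borel_of Y)"
    using f(2) act_in by (auto simp: space_pair_measure space_eta)
  finally show "(\<lambda>(g, x). act g x) -` U \<inter> space (\<eta> \<Otimes>\<^sub>M borel_of Y) \<in> sets (\<eta> \<Otimes>\<^sub>M borel_of Y)" .
qed

lemma orbit_map_measurable:
  assumes "x \<in> topspace Y"
  shows "(\<lambda>g. act g x) \<in> measurable \<eta> (borel_of Y)"
  using measurable_compose[OF measurable_Pair2'[of x "borel_of Y" \<eta>] act_jointly_measurable] assms
  by simp

lemma Cb_orbit_integrable: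
  assumes "h \<in> Cb Y" "x \<in> topspace Y"
  shows "integrable \<eta> (\<lambda>g. h (act g x))"
proof -
  obtain B where "\<And>x. x \<in> topspace Y \<Longrightarrow> \<bar>h x\<bar> \<le> B" using Cb_bound[OF assms(1)] by blast
  then show ?thesis
    by (intro integrable_const_bound[of _ B] orbit_measurable assms AE_I2)
      (use assms act_in space_eta in auto)
qed

lemma avg_bound:
  assumes "h \<in> Cb Y" "\<And>x. x \<in> topspace Y \<Longrightarrow> \<bar>h x\<bar> \<le> B" "x \<in> topspace Y"
  shows "\<bar>avg \<eta> act h x\<bar> \<le> B"
proof -
  have "\<bar>avg \<eta> act h x\<bar> \<le> (\<integral>g. \<bar>h (act g x)\<bar> \<partial>\<eta>)"
    unfolding avg_def by (rule integral_abs_bound)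
  also have "\<dots> \<le> B"
    by (rule integral_le_const)
      (use assms act_in space_eta Cb_orbit_integrable in \<open>auto intro!: AE_I2\<close>)
  finally show ?thesis .
qed

lemma avg_mono:
  assumes "f \<in> Cb Y" "h \<in> Cb Y" "\<And>x. x \<in> topspace Y \<Longrightarrow> f x \<le> h x" "x \<in> topspace Y"
  shows "avg \<eta> act f x \<le> avg \<eta> act h x"
  unfolding avg_def
proof (rule integral_mono)
  show "f (act g x) \<le> h (act g x)" if "g \<in> space \<eta>" for g
    using assms(3,4) act_in that space_eta by simp
qed (rule Cb_orbit_integrable; fact)+

text \<open>In a metrizable space continuity can be tested on sequences, and along a sequence
  dominated convergence applies with the bound of \<open>h\<close> as the constant majorant.\<close>

lemma avg_Cb:
  assumes h: "h \<in> Cb Y"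
  shows "avg \<eta> act h \<in> Cb Y"
proof -
  obtain M d where "Metric_space M d" and Yd: "Y = Metric_space.mtopology M d"
    using metrizable by (auto simp: metrizable_space_def)
  interpret Metric_space M d by fact
  have top: "topspace Y = M" using Yd by simp
  obtain B where B: "\<And>x. x \<in> topspace Y \<Longrightarrow> \<bar>h x\<bar> \<le> B" using Cb_bound[OF h] by blast
  have "continuous_map mtopology euclideanreal (avg \<eta> act h)"
  proof (rule continuous_map_sequentially)
    fix \<sigma> l assume \<sigma>: "range \<sigma> \<subseteq> M" and lim: "limitin mtopology \<sigma> l sequentially"
    have l: "l \<in> M" using lim limitin_mspace by blast
    have \<sigma>M: "\<sigma> n \<in> M" for n using \<sigma> by blast
    show "(\<lambda>n. avg \<eta> act h (\<sigma> n)) \<longlonglongrightarrow> avg \<eta> act h l"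
      unfolding avg_def
    proof (rule integral_dominated_convergence[where w = "\<lambda>_. B"])
      show "(\<lambda>g. h (act g l)) \<in> borel_measurable \<eta>"
        by (rule orbit_measurable) (use h l top in auto)
      show "(\<lambda>g. h (act g (\<sigma> n))) \<in> borel_measurable \<eta>" for n
        by (rule orbit_measurable) (use h \<sigma>M top in auto)
      show "AE g in \<eta>. (\<lambda>n. h (act g (\<sigma> n))) \<longlonglongrightarrow> h (act g l)"
      proof (rule AE_I2)
        fix g assume "g \<in> space \<eta>"
        then have "continuous_map mtopology euclideanreal (\<lambda>x. h (act g x))"
          using act_Cb[OF h, of g] space_eta Yd by (simp add: Cb_def)
        from continuous_map_limit[OF this lim]
        show "(\<lambda>n. h (act g (\<sigma> n))) \<longlonglongrightarrow> h (act g l)" by (simp add: o_def)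
      qed
      show "AE g in \<eta>. norm (h (act g (\<sigma> n))) \<le> B" for n
        by (rule AE_I2) (use B \<sigma>M top act_in space_eta in auto)
    qed simp
  qed
  moreover have "bounded (avg \<eta> act h ` topspace Y)"
    by (rule boundedI[where B = B]) (use avg_bound[OF h B] in auto)
  ultimately show ?thesis by (simp add: Cb_def Yd)
qed

text \<open>Left invariance is exactly what is needed here: since g acts after the integration
  variable k, the substitution replaces k by the product of g and k.\<close>

lemma avg_translate:
  assumes h: "h \<in> Cb Y" and g: "g \<in> carrier G" and x: "x \<in> topspace Y"
  shows "avg \<eta> act (\<lambda>y. h (act g y)) x = avg \<eta> act h x"
proof -
  have "avg \<eta> act h x = (\<integral>k. h (act k x) \<partial>distr \<eta> \<eta> (\<lambda>k. g \<otimes>\<^bsub>G\<^esub> k))"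
    by (simp add: avg_def left_invariant[OF g])
  also have "\<dots> = (\<integral>k. h (act (g \<otimes>\<^bsub>G\<^esub> k) x) \<partial>\<eta>)"
    by (rule integral_distr) (intro mult_measurable g orbit_measurable h x)+
  also have "\<dots> = avg \<eta> act (\<lambda>y. h (act g y)) x"
    unfolding avg_def by (rule Bochner_Integration.integral_cong) (simp_all add: act_mult g x space_eta)
  finally show ?thesis by simp
qed

text \<open>The map \<open>f\<close> allows two uses of Fubini: with the identity, for a measure on
  \<open>Y\<close>, and with an orbit map, for a second copy of \<open>\<eta>\<close>.\<close>

lemma pair_integrable:
  assumes h: "h \<in> Cb Y" and \<pi>: "prob_space \<pi>" and f: "f \<in> measurable \<pi> (borel_of Y)"
  shows "integrable (\<eta> \<Otimes>\<^sub>M \<pi>) (\<lambda>(g, x). h (act g (f x)))"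
proof -
  interpret \<pi>: prob_space \<pi> by fact
  interpret P: pair_prob_space \<eta> \<pi> ..
  obtain B where B: "\<And>x. x \<in> topspace Y \<Longrightarrow> \<bar>h x\<bar> \<le> B" using Cb_bound[OF h] by blast
  have f': "f x \<in> topspace Y" if "x \<in> space \<pi>" for x
    using measurable_space[OF f that] by simp
  have "(\<lambda>p. (fst p, f (snd p))) \<in> measurable (\<eta> \<Otimes>\<^sub>M \<pi>) (\<eta> \<Otimes>\<^sub>M borel_of Y)"
    using f by measurable
  from measurable_compose[OF measurable_compose[OF this act_jointly_measurable] Cb_borel_measurable[OF h]]
  have "(\<lambda>(g, x). h (act g (f x))) \<in> borel_measurable (\<eta> \<Otimes>\<^sub>M \<pi>)"
    by (simp add: split_beta')
  then show ?thesis
    by (intro P.integrable_const_bound[of _ B] AE_I2)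
      (use B f' act_in space_eta in \<open>auto simp: space_pair_measure\<close>)
qed

text \<open>Invariance of the average under x \<mapsto> \<open>act k x\<close> would call for right
  invariance of \<open>\<eta>\<close>. Fubini avoids it: with the order of integration exchanged,
  the inner integral is the average at x of \<open>h\<close> composed with \<open>act g\<close>, and
  \<open>avg_translate\<close> applies.\<close>

lemma avg_avg:
  assumes h: "h \<in> Cb Y" and x: "x \<in> topspace Y"
  shows "avg \<eta> act (avg \<eta> act h) x = avg \<eta> act h x"
proof -
  interpret P: pair_prob_space \<eta> \<eta> ..
  have "integrable (\<eta> \<Otimes>\<^sub>M \<eta>) (\<lambda>(g, k). h (act g (act k x)))"
    by (rule pair_integrable[OF h prob_space_axioms orbit_map_measurable[OF x]])
  then have "(\<integral>k. \<integral>g. h (act g (act k x)) \<partial>\<eta> \<partial>\<eta>) = (\<integral>g. \<integral>k. h (act g (act k x)) \<partial>\<eta> \<partial>\<eta>)"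
    by (rule P.Fubini_integral)
  also have "\<dots> = (\<integral>g. avg \<eta> act h x \<partial>\<eta>)"
    by (rule Bochner_Integration.integral_cong)
      (use avg_translate[OF h _ x] in \<open>simp_all add: avg_def space_eta\<close>)
  also have "\<dots> = avg \<eta> act h x" by (simp add: prob_space)
  finally show ?thesis by (simp add: avg_def)
qed

lemma integral_avg:
  assumes h: "h \<in> Cb Y" and \<pi>: "borel_prob Y \<pi>"
  shows "(\<integral>x. avg \<eta> act h x \<partial>\<pi>) = (\<integral>g. \<integral>x. h (act g x) \<partial>\<pi> \<partial>\<eta>)"
proof -
  have pr: "prob_space \<pi>" and s: "sets \<pi> = sets (borel_of Y)" using \<pi> by (auto simp: borel_prob_def)
  interpret \<pi>: prob_space \<pi> by fact
  interpret P: pair_prob_space \<eta> \<pi> ..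
  have "integrable (\<eta> \<Otimes>\<^sub>M \<pi>) (\<lambda>(g, x). h (act g x))"
    using pair_integrable[OF h pr measurable_ident_sets[OF s]] by simp
  then show ?thesis
    unfolding avg_def by (rule P.Fubini_integral)
qed

lemma integral_avg_invariant:
  assumes h: "h \<in> Cb Y" and \<pi>: "borel_prob Y \<pi>"
    and inv: "\<And>g. g \<in> carrier G \<Longrightarrow> (\<integral>x. h (act g x) \<partial>\<pi>) = (\<integral>x. h x \<partial>\<pi>)"
  shows "(\<integral>x. avg \<eta> act h x \<partial>\<pi>) = (\<integral>x. h x \<partial>\<pi>)"
proof -
  have "(\<integral>g. \<integral>x. h (act g x) \<partial>\<pi> \<partial>\<eta>) = (\<integral>g. \<integral>x. h x \<partial>\<pi> \<partial>\<eta>)"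
    by (rule Bochner_Integration.integral_cong) (simp_all add: inv space_eta)
  then show ?thesis by (simp add: integral_avg[OF h \<pi>] prob_space)
qed

text \<open>The convolution of \<open>\<eta>\<close> with \<open>\<pi>\<close>, that is, the law of
  \<open>act g x\<close> for independent g and x. As an image measure it is available without
  representing the functional h \<mapsto> \<integral> \<open>avg \<eta> act h\<close> d\<pi> by a
  measure.\<close>

definition avg_measure :: "'x measure \<Rightarrow> 'x measure" where
  "avg_measure \<pi> = distr (\<eta> \<Otimes>\<^sub>M \<pi>) (borel_of Y) (\<lambda>(g, x). act g x)"

lemma act_measurable_avg:
  assumes \<pi>: "borel_prob Y \<pi>"
  shows "(\<lambda>(g, x). act g x) \<in> measurable (\<eta> \<Otimes>\<^sub>M \<pi>) (borel_of Y)"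
proof -
  have s: "sets (\<eta> \<Otimes>\<^sub>M \<pi>) = sets (\<eta> \<Otimes>\<^sub>M borel_of Y)"
    using \<pi> by (intro sets_pair_measure_cong) (auto simp: borel_prob_def)
  show ?thesis
    using act_jointly_measurable by (simp only: measurable_cong_sets[OF s refl])
qed

lemma borel_prob_avg_measure:
  assumes \<pi>: "borel_prob Y \<pi>"
  shows "borel_prob Y (avg_measure \<pi>)"
proof -
  have pr: "prob_space \<pi>" using \<pi> by (simp add: borel_prob_def)
  interpret \<pi>: prob_space \<pi> by fact
  interpret P: pair_prob_space \<eta> \<pi> ..
  have "prob_space (avg_measure \<pi>)"
    unfolding avg_measure_def by (rule P.prob_space_distr[OF act_measurable_avg[OF \<pi>]])
  then show ?thesis by (simp add: borel_prob_def avg_measure_def)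
qed

lemma integral_avg_measure:
  assumes \<pi>: "borel_prob Y \<pi>" and h: "h \<in> Cb Y"
  shows "(\<integral>x. h x \<partial>avg_measure \<pi>) = (\<integral>x. avg \<eta> act h x \<partial>\<pi>)"
proof -
  have pr: "prob_space \<pi>" and s: "sets \<pi> = sets (borel_of Y)" using \<pi> by (auto simp: borel_prob_def)
  interpret \<pi>: prob_space \<pi> by fact
  interpret P: pair_prob_space \<eta> \<pi> ..
  have int: "integrable (\<eta> \<Otimes>\<^sub>M \<pi>) (\<lambda>(g, x). h (act g x))"
    using pair_integrable[OF h pr measurable_ident_sets[OF s]] by simp
  have "(\<integral>x. h x \<partial>avg_measure \<pi>) = (\<integral>p. h (case p of (g, x) \<Rightarrow> act g x) \<partial>(\<eta> \<Otimes>\<^sub>M \<pi>))"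
    unfolding avg_measure_def
    by (rule integral_distr[OF act_measurable_avg[OF \<pi>] Cb_borel_measurable[OF h]])
  also have "\<dots> = (\<integral>g. \<integral>x. h (act g x) \<partial>\<pi> \<partial>\<eta>)"
    using P.integral_fst[OF int] by (simp add: split_beta')
  finally show ?thesis by (simp add: integral_avg[OF h \<pi>])
qed

lemma avg_measure_invariant:
  assumes \<pi>: "borel_prob Y \<pi>" and h: "h \<in> Cb Y" and g: "g \<in> carrier G"
  shows "(\<integral>x. h (act g x) \<partial>avg_measure \<pi>) = (\<integral>x. h x \<partial>avg_measure \<pi>)"
proof -
  have "space \<pi> = topspace Y" using \<pi> sets_eq_imp_space_eq[of \<pi> "borel_of Y"] by (simp add: borel_prob_def)
  then have "(\<integral>x. avg \<eta> act (\<lambda>y. h (act g y)) x \<partial>\<pi>) = (\<integral>x. avg \<eta> act h x \<partial>\<pi>)"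
    by (intro Bochner_Integration.integral_cong refl avg_translate h g) simp
  then show ?thesis
    by (simp add: integral_avg_measure[OF \<pi>] h act_Cb g)
qed

text \<open>Applied to coordinate projections \<open>p\<close>, this shows that averaging preserves
  the marginals. By Fubini the image under \<open>p\<close> is a mixture over g of the images of the
  translates of \<open>\<pi>\<close>, all of which are equal to \<open>\<nu>\<close>.\<close>

lemma distr_avg_measure:
  assumes \<pi>: "borel_prob Y \<pi>" and p: "p \<in> measurable (borel_of Y) N" and N: "sets \<nu> = sets N"
    and inv: "\<And>g. g \<in> carrier G \<Longrightarrow> distr \<pi> N (\<lambda>x. p (act g x)) = \<nu>"
  shows "distr (avg_measure \<pi>) N p = \<nu>"
proof (rule measure_eqI)
  fix A assume "A \<in> sets (distr (avg_measure \<pi>) N p)"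
  then have A: "A \<in> sets N" by simp
  have pr: "prob_space \<pi>" and s: "sets \<pi> = sets (borel_of Y)" using \<pi> by (auto simp: borel_prob_def)
  interpret \<pi>: prob_space \<pi> by fact
  have comp: "(\<lambda>(g, x). p (act g x)) \<in> measurable (\<eta> \<Otimes>\<^sub>M \<pi>) N"
    using measurable_compose[OF act_measurable_avg[OF \<pi>] p] by (simp add: split_beta')
  let ?B = "(\<lambda>(g, x). p (act g x)) -` A \<inter> space (\<eta> \<Otimes>\<^sub>M \<pi>)"
  have B: "?B \<in> sets (\<eta> \<Otimes>\<^sub>M \<pi>)" by (rule measurable_sets[OF comp A])
  have "distr (avg_measure \<pi>) N p = distr (\<eta> \<Otimes>\<^sub>M \<pi>) N (\<lambda>(g, x). p (act g x))"
    unfolding avg_measure_def distr_distr[OF p act_measurable_avg[OF \<pi>]]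
    by (simp add: comp_def split_beta')
  then have "emeasure (distr (avg_measure \<pi>) N p) A = emeasure (\<eta> \<Otimes>\<^sub>M \<pi>) ?B"
    by (simp add: emeasure_distr[OF comp A])
  also have "\<dots> = (\<integral>\<^sup>+g. emeasure \<pi> (Pair g -` ?B) \<partial>\<eta>)"
    by (rule \<pi>.emeasure_pair_measure_alt[OF B])
  also have "\<dots> = (\<integral>\<^sup>+g. emeasure \<nu> A \<partial>\<eta>)"
  proof (rule nn_integral_cong)
    fix g assume g: "g \<in> space \<eta>"
    have "act g \<in> measurable \<pi> (borel_of Y)"
      unfolding measurable_cong_sets[OF s refl]
      using continuous_map_measurable act_continuous g space_eta by metis
    then have m: "(\<lambda>x. p (act g x)) \<in> measurable \<pi> N" by (rule measurable_compose[OF _ p])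
    have "Pair g -` ?B = (\<lambda>x. p (act g x)) -` A \<inter> space \<pi>"
      using g by (auto simp: space_pair_measure)
    then have "emeasure \<pi> (Pair g -` ?B) = emeasure (distr \<pi> N (\<lambda>x. p (act g x))) A"
      by (simp add: emeasure_distr[OF m A])
    then show "emeasure \<pi> (Pair g -` ?B) = emeasure \<nu> A" using inv g space_eta by simp
  qed
  also have "\<dots> = emeasure \<nu> A" by (simp add: emeasure_space_1)
  finally show "emeasure (distr (avg_measure \<pi>) N p) A = emeasure \<nu> A" .
qed (simp add: N)

end

section \<open>Finite transport problems\<close>

text \<open>Positive homogeneity is required as an inequality only: for r > 0 the reverse one
  follows by scaling with 1/r, and for r = 0 it follows from subadditivity.\<close>

definition sublinear :: "(('i \<Rightarrow> real) \<Rightarrow> real) \<Rightarrow> bool" where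
  "sublinear P \<longleftrightarrow> (\<forall>f g. P (\<lambda>i. f i + g i) \<le> P f + P g) \<and>
     (\<forall>r f. 0 \<le> r \<longrightarrow> P (\<lambda>i. r * f i) \<le> r * P f)"

lemma sublinear_add: "sublinear P \<Longrightarrow> P (\<lambda>i. f i + g i) \<le> P f + P g"
  by (simp add: sublinear_def)

lemma sublinear_scale: "sublinear P \<Longrightarrow> 0 \<le> r \<Longrightarrow> P (\<lambda>i. r * f i) \<le> r * P f"
  by (simp add: sublinear_def)

lemma sublinear_zero:
  assumes "sublinear P" shows "P (\<lambda>i. 0) = 0"
  using sublinear_scale[OF assms, of 0] sublinear_add[OF assms, of "\<lambda>i. 0" "\<lambda>i. 0"] by force

lemma sublinear_uminus:
  assumes "sublinear P" shows "0 \<le> P f + P (\<lambda>i. - f i)"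
  using sublinear_add[OF assms, of f "\<lambda>i. - f i"] sublinear_zero[OF assms] by simp

text \<open>One step of Hahn-Banach by decreasing the functional instead of extending one from a
  subspace: Q h is the infimum over s \<ge> 0 of P(h + s v) - s P v. Taking s = 0 gives Q \<le> P,
  and s = 1 gives Q(-v) \<le> - P v; since Q v + Q(-v) \<ge> 0, both values are then forced. The
  infimum is finite because - P(-h) is a lower bound.\<close>

lemma sublinear_linear_direction:
  assumes P: "sublinear P"
  obtains Q where "sublinear Q" "\<And>h. Q h \<le> P h" "Q v = P v" "Q (\<lambda>i. - v i) = - P v"
proof -
  define S where "S = (\<lambda>h. (\<lambda>s. P (\<lambda>i. h i + s * v i) - s * P v) ` {0..})"
  define Q where "Q = (\<lambda>h. Inf (S h))"
  have low: "- P (\<lambda>i. - h i) \<le> a" if "a \<in> S h" for h a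
  proof -
    obtain s where s: "0 \<le> s" "a = P (\<lambda>i. h i + s * v i) - s * P v" using \<open>a \<in> S h\<close> by (auto simp: S_def)
    have "P (\<lambda>i. s * v i) \<le> P (\<lambda>i. h i + s * v i) + P (\<lambda>i. - h i)"
      using sublinear_add[OF P, of "\<lambda>i. h i + s * v i" "\<lambda>i. - h i"] by simp
    moreover have "s * P v \<le> P (\<lambda>i. s * v i)"
    proof (cases "s = 0")
      case True then show ?thesis using sublinear_zero[OF P] by simp
    next
      case False
      then have "P v \<le> inverse s * P (\<lambda>i. s * v i)"
        using sublinear_scale[OF P, of "inverse s" "\<lambda>i. s * v i"] s(1) by (simp add: mult.assoc[symmetric])
      then show ?thesis using False s(1) by (simp add: field_simps)
    qed
    ultimately show ?thesis using s(2) by linarith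
  qed
  have Q_le: "Q h \<le> P (\<lambda>i. h i + s * v i) - s * P v" if "0 \<le> s" for h s
    unfolding Q_def using low that by (intro cInf_lower bdd_belowI[of _ "- P (\<lambda>i. - h i)"]) (auto simp: S_def)
  have Q_ge: "a \<le> Q h" if "\<And>s. 0 \<le> s \<Longrightarrow> a \<le> P (\<lambda>i. h i + s * v i) - s * P v" for a h
    unfolding Q_def using that by (intro cInf_greatest) (auto simp: S_def)
  have QP: "Q h \<le> P h" for h using Q_le[of 0 h] by simp
  have sub: "sublinear Q"
    unfolding sublinear_def
  proof (intro conjI allI impI)
    fix f g
    have "Q (\<lambda>i. f i + g i) - Q f \<le> P (\<lambda>i. g i + t * v i) - t * P v" if t: "0 \<le> t" for t
    proof -
      have "Q (\<lambda>i. f i + g i) - (P (\<lambda>i. g i + t * v i) - t * P v) \<le> Q f"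
      proof (rule Q_ge)
        fix s :: real assume s: "0 \<le> s"
        have "Q (\<lambda>i. f i + g i) \<le> P (\<lambda>i. (f i + g i) + (s + t) * v i) - (s + t) * P v"
          using s t by (intro Q_le) simp
        also have "P (\<lambda>i. (f i + g i) + (s + t) * v i) = P (\<lambda>i. (f i + s * v i) + (g i + t * v i))"
          by (simp add: algebra_simps)
        also have "\<dots> \<le> P (\<lambda>i. f i + s * v i) + P (\<lambda>i. g i + t * v i)"
          by (rule sublinear_add[OF P])
        finally show "Q (\<lambda>i. f i + g i) - (P (\<lambda>i. g i + t * v i) - t * P v)
            \<le> P (\<lambda>i. f i + s * v i) - s * P v"
          by (simp add: algebra_simps)
      qed
      then show ?thesis by linarith
    qed
    then have "Q (\<lambda>i. f i + g i) - Q f \<le> Q g" by (rule Q_ge)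
    then show "Q (\<lambda>i. f i + g i) \<le> Q f + Q g" by linarith
  next
    fix r :: real and f assume r: "0 \<le> r"
    show "Q (\<lambda>i. r * f i) \<le> r * Q f"
    proof (cases "r = 0")
      case True
      then show ?thesis using QP[of "\<lambda>i. 0"] sublinear_zero[OF P] by simp
    next
      case False
      then have r: "0 < r" using r by simp
      have "Q (\<lambda>i. r * f i) / r \<le> Q f"
      proof (rule Q_ge)
        fix s :: real assume s: "0 \<le> s"
        have "Q (\<lambda>i. r * f i) \<le> P (\<lambda>i. r * f i + (r * s) * v i) - (r * s) * P v"
          using s r by (intro Q_le) simp
        also have "P (\<lambda>i. r * f i + (r * s) * v i) = P (\<lambda>i. r * (f i + s * v i))"
          by (simp add: algebra_simps)
        also have "\<dots> \<le> r * P (\<lambda>i. f i + s * v i)"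
          using r by (intro sublinear_scale[OF P]) simp
        finally show "Q (\<lambda>i. r * f i) / r \<le> P (\<lambda>i. f i + s * v i) - s * P v"
          using r by (simp add: field_simps)
      qed
      then show ?thesis using r by (simp add: field_simps)
    qed
  qed
  have "Q (\<lambda>i. - v i) \<le> - P v" using Q_le[of 1 "\<lambda>i. - v i"] sublinear_zero[OF P] by simp
  with sublinear_uminus[OF sub, of v] QP[of v] have "Q v = P v" "Q (\<lambda>i. - v i) = - P v" by linarith+
  with that[of Q] sub QP show ?thesis by blast
qed

text \<open>Linearity in a direction survives later steps: if R \<le> Q is sublinear and Q(-u) = - Q
  u, then R(u) + R(-u) \<ge> 0 leaves R no room to drop below Q at u or -u. The direction
  \<open>w\<close> is treated first, while the functional is still \<open>P\<close>, so the value
  \<open>P w\<close> is kept.\<close>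

lemma sublinear_linear_on_finite:
  assumes "finite V" "sublinear P"
  shows "\<exists>Q. sublinear Q \<and> (\<forall>h. Q h \<le> P h) \<and> Q w = P w \<and>
    (\<forall>v\<in>insert w V. Q (\<lambda>i. - v i) = - Q v)"
  using assms(1)
proof induction
  case empty
  obtain Q where "sublinear Q" "\<And>h. Q h \<le> P h" "Q w = P w" "Q (\<lambda>i. - w i) = - P w"
    using sublinear_linear_direction[OF assms(2), of w] by blast
  then show ?case by (intro exI[of _ Q]) simp
next
  case (insert v V)
  then obtain Q where Q: "sublinear Q" "\<And>h. Q h \<le> P h" "Q w = P w"
    "\<And>v. v \<in> insert w V \<Longrightarrow> Q (\<lambda>i. - v i) = - Q v" by blast
  obtain R where R: "sublinear R" "\<And>h. R h \<le> Q h" "R v = Q v" "R (\<lambda>i. - v i) = - Q v"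
    using sublinear_linear_direction[OF Q(1), of v] by blast
  have *: "R u = Q u" "R (\<lambda>i. - u i) = - Q u" if "u \<in> insert w V" for u
    using R(2)[of u] R(2)[of "\<lambda>i. - u i"] Q(4)[OF that] sublinear_uminus[OF R(1), of u] by linarith+
  show ?case
  proof (intro exI[of _ R] conjI allI ballI)
    show "R h \<le> P h" for h using R(2)[of h] Q(2)[of h] by linarith
    show "R w = P w" using *(1)[of w] Q(3) by simp
    show "R (\<lambda>i. - u i) = - R u" if "u \<in> insert w (insert v V)" for u
      using that * R(3,4) by auto
  qed (rule R(1))
qed

text \<open>The coefficients are the values of the decreased functional on coordinate vectors. The
  index type may be infinite, so functions are cut off outside \<open>I\<close> by
  \<open>res\<close>, which by \<open>cong\<close> does not change \<open>P\<close>. Sublinearity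
  bounds Q by the linear form from above; the same bound at -h makes the two equal.\<close>

lemma sublinear_support_functional:
  fixes v :: "'i \<Rightarrow> real"
  assumes I: "finite I" and P: "sublinear P"
    and cong: "\<And>f g. (\<And>i. i \<in> I \<Longrightarrow> f i = g i) \<Longrightarrow> P f = P g"
  obtains q where "\<And>h. (\<Sum>i\<in>I. q i * h i) \<le> P h" "(\<Sum>i\<in>I. q i * v i) = P v"
proof -
  define \<delta> :: "'i \<Rightarrow> 'i \<Rightarrow> real" where "\<delta> = (\<lambda>i j. if j = i then 1 else 0)"
  define res where "res = (\<lambda>(h :: 'i \<Rightarrow> real) i. if i \<in> I then h i else 0)"
  obtain Q where Q: "sublinear Q" "\<And>h. Q h \<le> P h" "Q (res v) = P (res v)"
    and lin: "\<And>i. i \<in> I \<Longrightarrow> Q (\<lambda>j. - \<delta> i j) = - Q (\<delta> i)"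
    using sublinear_linear_on_finite[of "\<delta> ` I" P "res v"] I P by auto
  define q where "q = (\<lambda>i. Q (\<delta> i))"
  have scale: "Q (\<lambda>j. r * \<delta> i j) \<le> r * q i" if "i \<in> I" for r i
  proof (cases "0 \<le> r")
    case True
    then show ?thesis unfolding q_def by (rule sublinear_scale[OF Q(1)])
  next
    case False
    then have "Q (\<lambda>j. (- r) * (- \<delta> i j)) \<le> (- r) * Q (\<lambda>j. - \<delta> i j)"
      by (intro sublinear_scale[OF Q(1)]) simp
    then show ?thesis by (simp add: lin[OF that] q_def)
  qed
  have sum: "Q (\<lambda>j. \<Sum>i\<in>A. h i * \<delta> i j) \<le> (\<Sum>i\<in>A. q i * h i)" if "finite A" "A \<subseteq> I" for A h
    using that
  proof (induction A)
    case empty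
    then show ?case using sublinear_zero[OF Q(1)] by simp
  next
    case (insert i A)
    have "Q (\<lambda>j. h i * \<delta> i j + (\<Sum>i\<in>A. h i * \<delta> i j))
        \<le> Q (\<lambda>j. h i * \<delta> i j) + Q (\<lambda>j. \<Sum>i\<in>A. h i * \<delta> i j)"
      by (rule sublinear_add[OF Q(1)])
    also have "\<dots> \<le> h i * q i + (\<Sum>i\<in>A. q i * h i)"
      using insert scale[of i "h i"] by (intro add_mono) auto
    finally show ?case using insert by (simp add: mult.commute)
  qed
  have "(\<Sum>i\<in>I. h i * \<delta> i j) = res h j" for h j
    unfolding \<delta>_def res_def using I by (simp add: if_distrib[of "\<lambda>x. _ * x"] sum.delta' cong: if_cong)
  then have up: "Q (res h) \<le> (\<Sum>i\<in>I. q i * h i)" for h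
    using sum[OF I order_refl, of h] by simp
  have Pres: "P (res h) = P h" for h by (rule cong) (simp add: res_def)
  have le: "(\<Sum>i\<in>I. q i * h i) \<le> P h" for h
  proof -
    have "0 \<le> Q (res h) + Q (\<lambda>i. - res h i)" by (rule sublinear_uminus[OF Q(1)])
    moreover have "(\<lambda>i. - res h i) = res (\<lambda>i. - h i)" by (auto simp: res_def)
    moreover have "Q (res (\<lambda>i. - h i)) \<le> - (\<Sum>i\<in>I. q i * h i)"
      using up[of "\<lambda>i. - h i"] by (simp add: sum_negf)
    ultimately show ?thesis using Q(2)[of "res h"] Pres[of h] by simp
  qed
  show ?thesis
  proof (rule that)
    show "(\<Sum>i\<in>I. q i * v i) = P v"
      using le[of v] up[of v] Q(3) Pres[of v] by simp
  qed (rule le)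
qed

text \<open>\<open>P h\<close> is the cheapest price of potentials whose sum dominates h. It is a
  minimum problem, so the cost enters as - C and the potentials change sign at the end. Any linear q
  \<le> P is a coupling: testing with simple functions gives its sign and its marginals. Equality at
  - C leaves no duality gap; \<open>\<epsilon>\<close> is spent only on choosing potentials close to
  the infimum.\<close>

lemma finite_transport_duality:
  fixes p :: "'k \<Rightarrow> 'j \<Rightarrow> real" and C :: "('k \<Rightarrow> 'j) \<Rightarrow> real"
  assumes K: "finite K" "K \<noteq> {}" and J: "finite J"
    and p: "\<And>k j. k \<in> K \<Longrightarrow> j \<in> J \<Longrightarrow> 0 \<le> p k j" "\<And>k. k \<in> K \<Longrightarrow> (\<Sum>j\<in>J. p k j) = 1"
    and \<epsilon>: "0 < \<epsilon>"
  obtains q u where "\<And>i. i \<in> (K \<rightarrow>\<^sub>E J) \<Longrightarrow> 0 \<le> q i"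
    and "\<And>k j. k \<in> K \<Longrightarrow> j \<in> J \<Longrightarrow> (\<Sum>i | i \<in> (K \<rightarrow>\<^sub>E J) \<and> i k = j. q i) = p k j"
    and "\<And>i. i \<in> (K \<rightarrow>\<^sub>E J) \<Longrightarrow> (\<Sum>k\<in>K. u k (i k)) \<le> C i"
    and "(\<Sum>i\<in>(K \<rightarrow>\<^sub>E J). q i * C i) \<le> (\<Sum>k\<in>K. \<Sum>j\<in>J. p k j * u k j) + \<epsilon>"
proof -
  define I where "I = (K \<rightarrow>\<^sub>E J)"
  have I: "finite I" unfolding I_def using K J by (intro finite_PiE) auto
  define val where "val = (\<lambda>u. \<Sum>k\<in>K. \<Sum>j\<in>J. p k j * u k j)"
  define S where "S = (\<lambda>h. {val u | u. \<forall>i\<in>I. h i \<le> (\<Sum>k\<in>K. u k (i k))})"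
  define P where "P = (\<lambda>h. Inf (S h))"
  have avg_ge: "\<exists>j\<in>J. u j \<le> (\<Sum>j\<in>J. p k j * u j)" if "k \<in> K" for k and u :: "'j \<Rightarrow> real"
  proof -
    have "J \<noteq> {}" using p(2)[OF that] by auto
    then have m: "Min (u ` J) \<in> u ` J" using J by (intro Min_in) auto
    have "Min (u ` J) = (\<Sum>j\<in>J. p k j * Min (u ` J))"
      using p(2)[OF that] by (simp add: sum_distrib_right[symmetric])
    also have "\<dots> \<le> (\<Sum>j\<in>J. p k j * u j)"
      using J p(1)[OF that] by (intro sum_mono mult_left_mono) auto
    finally show ?thesis using m by auto
  qed
  \<comment> \<open>In each coordinate some index has a potential not above its
    \<open>p\<close>-mean. At the tuple of these indices the constraint reads h \<le> sum of the
    potentials \<le> \<open>val u\<close>, which bounds the value from below.\<close>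
  have low: "- (\<Sum>i\<in>I. \<bar>h i\<bar>) \<le> a" if "a \<in> S h" for a h
  proof -
    obtain u where u: "a = val u" "\<And>i. i \<in> I \<Longrightarrow> h i \<le> (\<Sum>k\<in>K. u k (i k))"
      using \<open>a \<in> S h\<close> by (auto simp: S_def)
    have "\<forall>k\<in>K. \<exists>j. j \<in> J \<and> u k j \<le> (\<Sum>j\<in>J. p k j * u k j)"
      using avg_ge[where u = "u _"] by blast
    from bchoice[OF this] obtain f
      where f: "\<And>k. k \<in> K \<Longrightarrow> f k \<in> J \<and> u k (f k) \<le> (\<Sum>j\<in>J. p k j * u k j)" by blast
    have i: "restrict f K \<in> I" using f by (auto simp: I_def)
    have "- (\<Sum>i\<in>I. \<bar>h i\<bar>) \<le> - \<bar>h (restrict f K)\<bar>"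
      using member_le_sum[OF i, of "\<lambda>i. \<bar>h i\<bar>"] I by simp
    also have "\<dots> \<le> (\<Sum>k\<in>K. u k (restrict f K k))" using u(2)[OF i] by linarith
    also have "\<dots> \<le> val u" unfolding val_def using f by (intro sum_mono) auto
    finally show ?thesis using u by simp
  qed
  have P_le: "P h \<le> val u" if "\<And>i. i \<in> I \<Longrightarrow> h i \<le> (\<Sum>k\<in>K. u k (i k))" for h u
    unfolding P_def
    using low that by (intro cInf_lower bdd_belowI[of _ "- (\<Sum>i\<in>I. \<bar>h i\<bar>)"]) (auto simp: S_def)
  have S_ne: "S h \<noteq> {}" for h
  proof -
    obtain k0 where k0: "k0 \<in> K" using K by auto
    let ?m = "\<Sum>i\<in>I. \<bar>h i\<bar>"
    have "h i \<le> (\<Sum>k\<in>K. ?m)" if "i \<in> I" for i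
    proof -
      have "h i \<le> ?m" using member_le_sum[OF that, of "\<lambda>i. \<bar>h i\<bar>"] I by force
      also have "\<dots> \<le> (\<Sum>k\<in>K. ?m)" by (rule member_le_sum[OF k0]) (auto simp: K sum_nonneg)
      finally show ?thesis .
    qed
    then have "val (\<lambda>_ _. ?m) \<in> S h" by (auto simp: S_def)
    then show ?thesis by blast
  qed
  have P_ge: "a \<le> P h" if "\<And>u. (\<And>i. i \<in> I \<Longrightarrow> h i \<le> (\<Sum>k\<in>K. u k (i k))) \<Longrightarrow> a \<le> val u" for a h
    unfolding P_def by (rule cInf_greatest[OF S_ne]) (use that in \<open>auto simp: S_def\<close>)
  have val_add: "val (\<lambda>k j. u k j + w k j) = val u + val w" for u w
    by (simp add: val_def algebra_simps sum.distrib)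
  have val_scale: "val (\<lambda>k j. r * u k j) = r * val u" for r u
    by (simp add: val_def sum_distrib_left mult.left_commute)
  have P: "sublinear P"
    unfolding sublinear_def
  proof (intro conjI allI impI)
    fix f g
    have "P (\<lambda>i. f i + g i) - P f \<le> P g"
    proof (rule P_ge)
      fix w assume w: "\<And>i. i \<in> I \<Longrightarrow> g i \<le> (\<Sum>k\<in>K. w k (i k))"
      have "P (\<lambda>i. f i + g i) - val w \<le> P f"
      proof (rule P_ge)
        fix u assume u: "\<And>i. i \<in> I \<Longrightarrow> f i \<le> (\<Sum>k\<in>K. u k (i k))"
        have "P (\<lambda>i. f i + g i) \<le> val (\<lambda>k j. u k j + w k j)"
          using u w by (intro P_le) (simp add: sum.distrib add_mono)
        then show "P (\<lambda>i. f i + g i) - val w \<le> val u" by (simp add: val_add)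
      qed
      then show "P (\<lambda>i. f i + g i) - P f \<le> val w" by linarith
    qed
    then show "P (\<lambda>i. f i + g i) \<le> P f + P g" by linarith
  next
    fix r :: real and f assume r: "0 \<le> r"
    show "P (\<lambda>i. r * f i) \<le> r * P f"
    proof (cases "r = 0")
      case True
      have "P (\<lambda>i. 0) \<le> val (\<lambda>_ _. 0)" by (intro P_le) simp
      then show ?thesis using True by (simp add: val_def)
    next
      case False
      then have r: "0 < r" using r by simp
      have "P (\<lambda>i. r * f i) / r \<le> P f"
      proof (rule P_ge)
        fix u assume u: "\<And>i. i \<in> I \<Longrightarrow> f i \<le> (\<Sum>k\<in>K. u k (i k))"
        have "P (\<lambda>i. r * f i) \<le> val (\<lambda>k j. r * u k j)"
          using u r by (intro P_le) (simp add: sum_distrib_left[symmetric])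
        then show "P (\<lambda>i. r * f i) / r \<le> val u" using r by (simp add: val_scale field_simps)
      qed
      then show ?thesis using r by (simp add: field_simps)
    qed
  qed
  have P_cong: "P f = P g" if "\<And>i. i \<in> I \<Longrightarrow> f i = g i" for f g
    unfolding P_def S_def using that by simp
  obtain q where q: "\<And>h. (\<Sum>i\<in>I. q i * h i) \<le> P h" "(\<Sum>i\<in>I. q i * - C i) = P (\<lambda>i. - C i)"
    using sublinear_support_functional[OF I P P_cong, of "\<lambda>i. - C i"] by blast
  have "P (\<lambda>i. - C i) < P (\<lambda>i. - C i) + \<epsilon>" using \<epsilon> by simp
  then obtain a where "a \<in> S (\<lambda>i. - C i)" and a: "a < P (\<lambda>i. - C i) + \<epsilon>"
    using S_ne unfolding P_def by (metis cInf_lessD)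
  then obtain u where u: "a = val u" "\<And>i. i \<in> I \<Longrightarrow> - C i \<le> (\<Sum>k\<in>K. u k (i k))"
    by (auto simp: S_def)
  show ?thesis
  proof (rule that[of q "\<lambda>k j. - u k j"], goal_cases)
    case (1 i)
    then have i: "i \<in> I" by (simp add: I_def)
    \<comment> \<open>Testing with minus a unit vector, dominated by the zero potentials, shows that
      \<open>q i\<close> is nonnegative.\<close>
    have "(\<Sum>i'\<in>I. q i' * (if i' = i then -1 else 0)) \<le> P (\<lambda>i'. if i' = i then -1 else 0)"
      by (rule q(1))
    also have "\<dots> \<le> val (\<lambda>_ _. 0)" by (intro P_le) simp
    finally have "(\<Sum>i'\<in>I. q i' * (if i' = i then -1 else 0)) \<le> 0" by (simp add: val_def)
    moreover have "(\<Sum>i'\<in>I. q i' * (if i' = i then -1 else 0)) = - q i"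
      using I i by (simp add: if_distrib[of "\<lambda>x. _ * x"] cong: if_cong)
    ultimately show ?case by simp
  next
    case (2 k j)
    \<comment> \<open>The function r times the indicator of \<open>i k = j\<close> is itself a sum
      of potentials, so its price is at most \<open>r * p k j\<close>; the signs r = 1 and r = -1
      together give the marginal condition.\<close>
    have *: "r * (\<Sum>i | i \<in> I \<and> i k = j. q i) \<le> r * p k j" for r
    proof -
      let ?u = "\<lambda>k' j'. if k' = k \<and> j' = j then r else 0"
      let ?h = "\<lambda>i. \<Sum>k'\<in>K. ?u k' (i k')"
      have h: "?h i = (if i k = j then r else 0)" for i
      proof -
        have "?h i = (\<Sum>k'\<in>K. if k' = k then (if i k = j then r else 0) else 0)"
          by (intro sum.cong) auto
        then show ?thesis using K 2 by simp
      qed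
      have "(\<Sum>i\<in>I. q i * ?h i) \<le> P ?h" by (rule q(1))
      also have "\<dots> \<le> val ?u" by (intro P_le) simp
      also have "val ?u = (\<Sum>k'\<in>K. if k' = k then r * p k j else 0)"
        unfolding val_def
      proof (rule sum.cong[OF refl])
        fix k' assume "k' \<in> K"
        have "(\<Sum>j'\<in>J. p k' j' * ?u k' j') = (\<Sum>j'\<in>J. if j' = j then (if k' = k then p k j * r else 0) else 0)"
          by (intro sum.cong) auto
        then show "(\<Sum>j'\<in>J. p k' j' * ?u k' j') = (if k' = k then r * p k j else 0)"
          using J 2 by simp
      qed
      also have "\<dots> = r * p k j" using K 2 by simp
      also have "(\<Sum>i\<in>I. q i * ?h i) = (\<Sum>i\<in>I. if i k = j then r * q i else 0)"
        unfolding h by (intro sum.cong) auto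
      also have "\<dots> = r * (\<Sum>i | i \<in> I \<and> i k = j. q i)"
        using I by (simp add: sum.If_cases sum_distrib_left Int_def)
      finally show ?thesis .
    qed
    show ?case using *[of 1] *[of "-1"] by (simp add: I_def)
  next
    case (3 i)
    then show ?case using u(2)[of i] by (simp add: I_def sum_negf)
  next
    case 4
    have "- (\<Sum>i\<in>I. q i * C i) = P (\<lambda>i. - C i)" using q(2) by (simp add: sum_negf)
    then show ?case using a u(1) by (simp add: val_def sum_negf I_def)
  qed
qed

section \<open>Compact sets and cells\<close>

text \<open>The centres may lie outside \<open>S\<close>: each closed ball of radius r/3 that meets
  \<open>S\<close> is recentred at a point of \<open>S\<close>, at the price of doubling the radius.
  Closed balls are the form in which the covers arise in the proof of tightness.\<close>

lemma (in Metric_space) mtotally_boundedI: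
  assumes S: "S \<subseteq> M"
    and cover: "\<And>r. 0 < r \<Longrightarrow> \<exists>F. finite F \<and> F \<subseteq> M \<and> S \<subseteq> (\<Union>x\<in>F. mcball x r)"
  shows "mtotally_bounded S"
  unfolding mtotally_bounded_def
proof (intro allI impI)
  fix r :: real assume r: "0 < r"
  then obtain F where F: "finite F" "F \<subseteq> M" "S \<subseteq> (\<Union>x\<in>F. mcball x (r / 3))"
    using cover[of "r / 3"] by auto
  define F' where "F' = {x \<in> F. S \<inter> mcball x (r / 3) \<noteq> {}}"
  have "\<forall>x\<in>F'. \<exists>y. y \<in> S \<inter> mcball x (r / 3)" by (auto simp: F'_def)
  from bchoice[OF this] obtain y where y: "\<forall>x\<in>F'. y x \<in> S \<inter> mcball x (r / 3)" by blast
  show "\<exists>K. finite K \<and> K \<subseteq> S \<and> S \<subseteq> (\<Union>x\<in>K. mball x r)"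
  proof (intro exI[of _ "y ` F'"] conjI)
    show "finite (y ` F')" using F by (simp add: F'_def)
    show "y ` F' \<subseteq> S" using y by auto
    show "S \<subseteq> (\<Union>x\<in>y ` F'. mball x r)"
    proof
      fix s assume s: "s \<in> S"
      then obtain x where x: "x \<in> F" "s \<in> mcball x (r / 3)" using F by blast
      then have xF: "x \<in> F'" using s by (auto simp: F'_def)
      then have yx: "y x \<in> M" "d x (y x) \<le> r / 3" using y S by auto
      have "d (y x) s \<le> d (y x) x + d x s"
        using x F yx s S by (intro triangle) auto
      then have "d (y x) s < r" using yx x r commute[of x "y x"] by auto
      then have "s \<in> mball (y x) r" using yx s S by auto
      then show "s \<in> (\<Union>x\<in>y ` F'. mball x r)" using xF by blast
    qed
  qed
qed

text \<open>Ulam's theorem. For each m, finitely many closed balls of radius 1/(m+1) around points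
  of a dense sequence miss mass less than \<epsilon> / 2^(m+1). The intersection over m of these
  finite unions is closed and totally bounded, hence compact by completeness, and the missing masses
  add up to at most \<epsilon>.\<close>

lemma Polish_space_tight:
  assumes X: "Polish_space X" and \<mu>: "borel_prob X \<mu>" and \<epsilon>: "0 < \<epsilon>"
  obtains K where "compactin X K" "K \<in> sets \<mu>" "measure \<mu> (space \<mu> - K) \<le> \<epsilon>"
proof -
  obtain M d where "Metric_space M d" and comp: "Metric_space.mcomplete M d"
    and Xd: "X = Metric_space.mtopology M d"
    using X by (auto simp: Polish_space_def completely_metrizable_space_def)
  interpret Metric_space M d by fact
  have pr: "prob_space \<mu>" and sets: "sets \<mu> = sets (borel_of X)" using \<mu> by (auto simp: borel_prob_def)
  interpret \<mu>: prob_space \<mu> by fact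
  have space: "space \<mu> = M" using sets_eq_imp_space_eq[OF sets] Xd by simp
  obtain D where D: "countable D" "D \<subseteq> M" "(mtopology closure_of D) = M"
    using X by (auto simp: separable_space_def Xd Polish_space_def)
  have "D \<noteq> {}" using D(3) \<mu>.not_empty space by auto
  then obtain e :: "nat \<Rightarrow> 'a" where e: "range e = D"
    using D(1) range_from_nat_into by metis
  define B where "B = (\<lambda>m N. \<Union>j\<le>N. mcball (e j) (inverse (real (Suc m))))"
  have closedB: "closedin X (B m N)" for m N
    unfolding B_def Xd by (intro closedin_Union) auto
  then have setsB: "B m N \<in> sets \<mu>" for m N
    using closedin_sets_borel_of sets by blast
  have UB: "(\<Union>N. B m N) = M" for m
  proof
    show "M \<subseteq> (\<Union>N. B m N)"
    proof
      fix x assume x: "x \<in> M"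
      then have "x \<in> mtopology closure_of D" using D by simp
      moreover have "0 < inverse (real (Suc m))" by simp
      ultimately obtain y where "y \<in> D" "y \<in> mcball x (inverse (real (Suc m)))"
        unfolding metric_closure_of_alt by blast
      then obtain j where "x \<in> mcball (e j) (inverse (real (Suc m)))"
        using e D x by (auto simp: commute)
      then show "x \<in> (\<Union>N. B m N)" unfolding B_def by blast
    qed
  qed (auto simp: B_def)
  have "\<exists>N. measure \<mu> (M - B m N) < \<epsilon> * (1 / 2) ^ Suc m" for m
  proof -
    have "incseq (B m)" by (force simp: incseq_def B_def)
    then have "(\<lambda>N. measure \<mu> (B m N)) \<longlonglongrightarrow> measure \<mu> (\<Union>N. B m N)"
      using setsB by (intro \<mu>.finite_Lim_measure_incseq) auto
    then have "(\<lambda>N. measure \<mu> (B m N)) \<longlonglongrightarrow> 1" using \<mu>.prob_space UB space by simp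
    moreover have "1 - \<epsilon> * (1 / 2) ^ Suc m < 1" using \<epsilon> by simp
    ultimately have "\<forall>\<^sub>F N in sequentially. 1 - \<epsilon> * (1 / 2) ^ Suc m < measure \<mu> (B m N)"
      by (rule order_tendstoD)
    then obtain N where "1 - \<epsilon> * (1 / 2) ^ Suc m < measure \<mu> (B m N)"
      by (auto simp: eventually_sequentially)
    then show ?thesis using \<mu>.prob_compl[OF setsB[of m N]] space by (intro exI[of _ N]) simp
  qed
  then obtain N where N: "\<And>m. measure \<mu> (M - B m (N m)) < \<epsilon> * (1 / 2) ^ Suc m" by metis
  define K where "K = (\<Inter>m. B m (N m))"
  have "K \<subseteq> B 0 (N 0)" by (auto simp: K_def)
  also have "B 0 (N 0) \<subseteq> M" by (auto simp: B_def)
  finally have KM: "K \<subseteq> M" .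
  have clK: "closedin X K" unfolding K_def using closedB by (intro closedin_Inter) auto
  have "mtotally_bounded K"
  proof (rule mtotally_boundedI[OF KM])
    fix r :: real assume r: "0 < r"
    then obtain m where m: "inverse (real (Suc m)) < r" using reals_Archimedean by blast
    show "\<exists>F. finite F \<and> F \<subseteq> M \<and> K \<subseteq> (\<Union>x\<in>F. mcball x r)"
    proof (intro exI[of _ "e ` {..N m}"] conjI)
      show "e ` {..N m} \<subseteq> M" using e D by auto
      have "K \<subseteq> B m (N m)" by (auto simp: K_def)
      also have "\<dots> \<subseteq> (\<Union>x\<in>e ` {..N m}. mcball x r)" using m by (fastforce simp: B_def)
      finally show "K \<subseteq> (\<Union>x\<in>e ` {..N m}. mcball x r)" .
    qed simp
  qed
  then have "compactin X K"
    using mtotally_bounded_eq_compact_closure_of[OF comp, of K] clK Xd by (simp add: closure_of_closedin)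
  moreover have Ks: "K \<in> sets \<mu>" using closedin_sets_borel_of[OF clK] sets by simp
  moreover have "measure \<mu> (space \<mu> - K) \<le> \<epsilon>"
  proof -
    have s: "(\<lambda>m. \<epsilon> * (1 / 2) ^ Suc m) sums (\<epsilon> * 1)"
      using power_half_series by (rule sums_mult)
    have summ: "summable (\<lambda>m. measure \<mu> (M - B m (N m)))"
      by (rule summable_comparison_test'[OF sums_summable[OF s]]) (use N in \<open>auto intro: less_imp_le\<close>)
    have "space \<mu> - K = (\<Union>m. M - B m (N m))" by (auto simp: K_def space)
    also have "measure \<mu> \<dots> \<le> (\<Sum>m. measure \<mu> (M - B m (N m)))"
      using summ setsB sets.compl_sets[of _ \<mu>] space
      by (intro \<mu>.finite_measure_subadditive_countably) auto
    also have "\<dots> \<le> (\<Sum>m. \<epsilon> * (1 / 2) ^ Suc m)"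
      by (intro suminf_le summ sums_summable[OF s] less_imp_le N)
    also have "\<dots> = \<epsilon>" using sums_unique[OF s] by simp
    finally show ?thesis .
  qed
  ultimately show ?thesis by (rule that)
qed

text \<open>A point is indexed by the first ball of a finite \<delta>/2-cover of \<open>K\<close>
  that contains it. The cells partition all of \<open>M\<close>, but only those meeting
  \<open>K\<close> are small; the last claim therefore places only one of the two points in
  \<open>K\<close>.\<close>

lemma (in Metric_space) compactin_small_cells:
  assumes K: "compactin mtopology K" and \<delta>: "0 < \<delta>"
  obtains idx :: "'a \<Rightarrow> nat" where "idx \<in> measurable (borel_of mtopology) (count_space UNIV)"
    and "finite (idx ` M)"
    and "\<And>x y. x \<in> K \<Longrightarrow> y \<in> M \<Longrightarrow> idx x = idx y \<Longrightarrow> d x y < \<delta>"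
proof -
  have "mtotally_bounded K" using K by (rule compactin_imp_mtotally_bounded)
  then have "\<exists>F. finite F \<and> F \<subseteq> K \<and> K \<subseteq> (\<Union>x\<in>F. mball x (\<delta> / 2))"
    using \<delta> by (simp add: mtotally_bounded_def)
  then obtain F where F: "finite F" "F \<subseteq> K" "K \<subseteq> (\<Union>x\<in>F. mball x (\<delta> / 2))"
    by blast
  obtain zs where zs: "set zs = F" using finite_list[OF F(1)] by blast
  define N where "N = length zs"
  \<comment> \<open>The index \<open>N\<close> is the default for points in none of the balls. It
    keeps \<open>LEAST\<close> defined, and no point of \<open>K\<close> receives it.\<close>
  define idx where "idx = (\<lambda>x. LEAST j. j = N \<or> x \<in> mball (zs ! j) (\<delta> / 2))"
  have idx: "idx x = N \<or> x \<in> mball (zs ! idx x) (\<delta> / 2)" for x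
    unfolding idx_def by (rule LeastI[of _ N]) simp
  have idx_le: "idx x \<le> N" for x unfolding idx_def by (rule Least_le) simp
  show ?thesis
  proof (rule that[of idx])
    have "(\<lambda>x. j = N \<or> x \<in> mball (zs ! j) (\<delta> / 2)) \<in> measurable (borel_of mtopology) (count_space UNIV)" for j
    proof -
      have "{x \<in> space (borel_of mtopology). j = N \<or> x \<in> mball (zs ! j) (\<delta> / 2)}
          = (if j = N then M else mball (zs ! j) (\<delta> / 2))" by auto
      also have "\<dots> \<in> sets (borel_of mtopology)"
        by (auto intro!: openin_sets_borel_of simp del: in_mball)
      finally show ?thesis unfolding pred_def .
    qed
    then show "idx \<in> measurable (borel_of mtopology) (count_space UNIV)"
      unfolding idx_def by (rule measurable_Least)
    show "finite (idx ` M)" by (rule finite_subset[of _ "{..N}"]) (use idx_le in auto)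
    fix x y assume x: "x \<in> K" and y: "y \<in> M" and eq: "idx x = idx y"
    obtain z where "z \<in> F" "x \<in> mball z (\<delta> / 2)" using F x by blast
    then obtain j where j: "j < N" "x \<in> mball (zs ! j) (\<delta> / 2)"
      using zs by (auto simp: in_set_conv_nth N_def)
    then have "idx x \<le> j" unfolding idx_def by (intro Least_le) simp
    then have ne: "idx x \<noteq> N" using j by simp
    have "x \<in> mball (zs ! idx x) (\<delta> / 2)" "y \<in> mball (zs ! idx x) (\<delta> / 2)"
      using idx[of x] idx[of y] ne eq by auto
    then show "d x y < \<delta>" using triangle''[of x "zs ! idx x" y] by auto
  qed
qed

text \<open>Uniform continuity in which only one of the two points is confined to the compact box.
  The Lebesgue number argument still works: around each x the cost is controlled on a ball of twice
  the radius \<open>\<rho> x\<close>, and finitely many balls of the single radius cover the box.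
  Balls are boxes of balls of the factors, so no metric on the product is chosen.\<close>

lemma product_uniform_near_compact:
  fixes c :: "('k \<Rightarrow> 'a) \<Rightarrow> real"
  assumes I: "finite I"
    and X: "\<And>k. k \<in> I \<Longrightarrow> Metric_space (topspace (X k)) (d k)"
      "\<And>k. k \<in> I \<Longrightarrow> X k = Metric_space.mtopology (topspace (X k)) (d k)"
    and c: "continuous_map (product_topology X I) euclideanreal c"
    and K: "\<And>k. k \<in> I \<Longrightarrow> compactin (X k) (K k)" and \<epsilon>: "0 < \<epsilon>"
  obtains r where "0 < r" "\<And>x z. x \<in> Pi\<^sub>E I K \<Longrightarrow> z \<in> topspace (product_topology X I) \<Longrightarrow>
    (\<And>k. k \<in> I \<Longrightarrow> d k (x k) (z k) < r) \<Longrightarrow> \<bar>c z - c x\<bar> < \<epsilon>"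
proof -
  let ?P = "product_topology X I"
  let ?T = "topspace ?P"
  define ball where "ball = (\<lambda>x r. \<Pi>\<^sub>E k\<in>I. Metric_space.mball (topspace (X k)) (d k) (x k) r)"
  have openball: "openin ?P (ball x r)" for x r
    unfolding ball_def
    using X(2) Metric_space.openin_mball[OF X(1)] by (intro openin_PiE[OF I, THEN iffD2] disjI2 ballI) metis
  have in_ball: "z \<in> ball x r \<longleftrightarrow> z \<in> ?T \<and> (\<forall>k\<in>I. x k \<in> topspace (X k) \<and> d k (x k) (z k) < r)" for x z r
    using Metric_space.in_mball[OF X(1)] by (auto simp: ball_def PiE_iff)
  have KT: "Pi\<^sub>E I K \<subseteq> ?T" using K compactin_subset_topspace by (auto simp: PiE_iff) blast
  have "\<exists>r>0. \<forall>z\<in>ball x (2 * r). \<bar>c z - c x\<bar> < \<epsilon> / 2" if x: "x \<in> ?T" for x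
  proof -
    let ?U = "{z \<in> ?T. c z \<in> {c x - \<epsilon> / 2<..<c x + \<epsilon> / 2}}"
    have "openin ?P ?U" using c by (intro openin_continuous_map_preimage[OF c]) simp
    moreover have "x \<in> ?U" using x \<epsilon> by simp
    ultimately obtain W where W: "x \<in> Pi\<^sub>E I W" "\<And>i. openin (X i) (W i)" "Pi\<^sub>E I W \<subseteq> ?U"
      using product_topology_open_contains_basis[of X I ?U x] by auto
    have "\<exists>s>0. Metric_space.mball (topspace (X k)) (d k) (x k) s \<subseteq> W k" if "k \<in> I" for k
    proof -
      interpret Metric_space "topspace (X k)" "d k" using X(1) that .
      have "openin mtopology (W k)" using W(2)[of k] X(2)[OF that] by simp
      moreover have "x k \<in> W k" using W(1) that by auto
      ultimately show ?thesis unfolding openin_mtopology by blast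
    qed
    then have "\<forall>k\<in>I. \<exists>s. s > 0 \<and> Metric_space.mball (topspace (X k)) (d k) (x k) s \<subseteq> W k" by blast
    from bchoice[OF this] obtain s where
      s: "\<forall>k\<in>I. s k > 0 \<and> Metric_space.mball (topspace (X k)) (d k) (x k) (s k) \<subseteq> W k" by blast
    \<comment> \<open>Inserting 1 keeps \<open>Min\<close> meaningful when \<open>I\<close> is
      empty; the halving makes the doubled radius fit.\<close>
    define r where "r = Min (insert 1 (s ` I)) / 2"
    have r: "0 < r" "\<And>k. k \<in> I \<Longrightarrow> 2 * r \<le> s k"
      using I s by (auto simp: r_def)
    have "\<bar>c z - c x\<bar> < \<epsilon> / 2" if z: "z \<in> ball x (2 * r)" for z
    proof -
      have "z k \<in> W k" if k: "k \<in> I" for k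
      proof -
        have "d k (x k) (z k) < s k" using z k r(2)[OF k] by (auto simp: in_ball intro: less_le_trans)
        then have "z k \<in> Metric_space.mball (topspace (X k)) (d k) (x k) (s k)"
          using z k Metric_space.in_mball[OF X(1)[OF k]] by (auto simp: in_ball PiE_iff)
        then show ?thesis using s k by blast
      qed
      then have "z \<in> Pi\<^sub>E I W" using z by (auto simp: in_ball PiE_iff)
      then have "z \<in> ?U" using W(3) by blast
      then have "c x - \<epsilon> / 2 < c z \<and> c z < c x + \<epsilon> / 2" by simp
      then show ?thesis by linarith
    qed
    then show ?thesis using r(1) by blast
  qed
  then have "\<forall>x\<in>?T. \<exists>r. r > 0 \<and> (\<forall>z\<in>ball x (2 * r). \<bar>c z - c x\<bar> < \<epsilon> / 2)" by blast
  from bchoice[OF this] obtain \<rho>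
    where \<rho>: "\<forall>x\<in>?T. \<rho> x > 0 \<and> (\<forall>z\<in>ball x (2 * \<rho> x). \<bar>c z - c x\<bar> < \<epsilon> / 2)" by blast
  have self: "x \<in> ball x (\<rho> x)" if x: "x \<in> ?T" for x
  proof -
    have "d k (x k) (x k) < \<rho> x" if "k \<in> I" for k
      using Metric_space.mdist_zero[OF X(1)[OF that], of "x k"] x that \<rho> by (auto simp: PiE_iff)
    then show ?thesis using x by (auto simp: in_ball PiE_iff)
  qed
  have "compactin ?P (Pi\<^sub>E I K)" using K by (simp add: compactin_PiE)
  moreover have "Pi\<^sub>E I K \<subseteq> \<Union>((\<lambda>x. ball x (\<rho> x)) ` Pi\<^sub>E I K)" using self KT by blast
  ultimately have "\<exists>\<F>. finite \<F> \<and> \<F> \<subseteq> (\<lambda>x. ball x (\<rho> x)) ` Pi\<^sub>E I K \<and> Pi\<^sub>E I K \<subseteq> \<Union>\<F>"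
    by (intro compactinD) (use openball in auto)
  then obtain \<F> where \<F>: "finite \<F>" "\<F> \<subseteq> (\<lambda>x. ball x (\<rho> x)) ` Pi\<^sub>E I K" "Pi\<^sub>E I K \<subseteq> \<Union>\<F>"
    by blast
  then obtain F where F: "finite F" "F \<subseteq> Pi\<^sub>E I K" "\<F> = (\<lambda>x. ball x (\<rho> x)) ` F"
    by (meson finite_subset_image)
  define r where "r = Min (insert 1 (\<rho> ` F))"
  have "0 < \<rho> y" if "y \<in> F" for y using that F(2) KT \<rho> by blast
  then have r: "0 < r" "\<And>y. y \<in> F \<Longrightarrow> r \<le> \<rho> y"
    using F(1) by (auto simp: r_def)
  show ?thesis
  proof (rule that[OF r(1)])
    fix x z assume x: "x \<in> Pi\<^sub>E I K" and z: "z \<in> ?T" and close: "\<And>k. k \<in> I \<Longrightarrow> d k (x k) (z k) < r"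
    obtain y where y: "y \<in> F" "x \<in> ball y (\<rho> y)" using \<F>(3) F(3) x by auto
    have yT: "y \<in> ?T" using y F KT by blast
    have xT: "x \<in> ?T" using x KT by blast
    have "\<rho> y > 0" using \<rho> yT by blast
    then have "x \<in> ball y (2 * \<rho> y)" using y(2) by (fastforce simp: in_ball)
    moreover have "z \<in> ball y (2 * \<rho> y)"
      unfolding in_ball
    proof (intro conjI z ballI)
      fix k assume k: "k \<in> I"
      show yk: "y k \<in> topspace (X k)" using yT k by (auto simp: PiE_iff)
      have "d k (y k) (z k) \<le> d k (y k) (x k) + d k (x k) (z k)"
        using Metric_space.triangle[OF X(1)[OF k] yk] xT z k by (auto simp: PiE_iff)
      moreover have "d k (y k) (x k) < \<rho> y" using y(2) k by (auto simp: in_ball)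
      ultimately show "d k (y k) (z k) < 2 * \<rho> y" using close[OF k] r(2)[OF y(1)] by linarith
    qed
    ultimately have "\<bar>c x - c y\<bar> < \<epsilon> / 2" "\<bar>c z - c y\<bar> < \<epsilon> / 2" using \<rho> yT by blast+
    then show "\<bar>c z - c x\<bar> < \<epsilon>" by linarith
  qed
qed

section \<open>Kantorovich duality\<close>

text \<open>The coupling picks a tuple of cells with probabilities \<open>q\<close> and then,
  independently for each k, a point of its cell distributed as \<open>M k\<close> conditioned on
  that cell. Relative to the product measure this is the density \<open>t i\<close> on
  \<open>box i\<close>. A vanishing denominator does no harm: \<open>q i\<close> is at most each
  \<open>p k (i k)\<close>, hence zero as well, and division by zero yields zero.\<close>

lemma coupling_of_cells:
  fixes M :: "'k \<Rightarrow> 'a measure" and idx :: "'k \<Rightarrow> 'a \<Rightarrow> 'j" and q :: "('k \<Rightarrow> 'j) \<Rightarrow> real"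
  assumes I: "finite I" "I \<noteq> {}" and J: "finite J"
    and M: "\<And>k. k \<in> I \<Longrightarrow> prob_space (M k)"
    and idx: "\<And>k. k \<in> I \<Longrightarrow> idx k \<in> measurable (M k) (count_space UNIV)"
    and idxJ: "\<And>k x. k \<in> I \<Longrightarrow> x \<in> space (M k) \<Longrightarrow> idx k x \<in> J"
    and q0: "\<And>i. i \<in> (I \<rightarrow>\<^sub>E J) \<Longrightarrow> 0 \<le> q i"
    and q: "\<And>k j. k \<in> I \<Longrightarrow> j \<in> J \<Longrightarrow>
      (\<Sum>i | i \<in> (I \<rightarrow>\<^sub>E J) \<and> i k = j. q i) = measure (M k) {x \<in> space (M k). idx k x = j}"
  obtains \<pi> where "sets \<pi> = sets (PiM I M)" "prob_space \<pi>"
    and "\<And>k. k \<in> I \<Longrightarrow> distr \<pi> (M k) (\<lambda>x. x k) = M k"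
    and "\<And>i. i \<in> (I \<rightarrow>\<^sub>E J) \<Longrightarrow> measure \<pi> {x \<in> space (PiM I M). \<forall>k\<in>I. idx k (x k) = i k} = q i"
proof -
  define cell where "cell = (\<lambda>k j. {x \<in> space (M k). idx k x = j})"
  define p where "p = (\<lambda>k j. measure (M k) (cell k j))"
  define box where "box = (\<lambda>i. \<Pi>\<^sub>E k\<in>I. cell k (i k))"
  define t where "t = (\<lambda>i. q i / (\<Prod>k\<in>I. p k (i k)))"
  define Ind where "Ind = (I \<rightarrow>\<^sub>E J)"
  define PM where "PM = PiM I M"
  have Ind: "finite Ind" unfolding Ind_def using I J by (intro finite_PiE) auto
  obtain k0 where k0: "k0 \<in> I" using I by auto
  \<comment> \<open>The locale for product measures asks for a probability space at every index, so
    outside \<open>I\<close> the family is filled with \<open>M k0\<close>.\<close>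
  define N where "N = (\<lambda>k. if k \<in> I then M k else M k0)"
  have N: "prob_space (N k)" for k using M k0 by (simp add: N_def)
  interpret product_prob_space N I
    by (intro product_prob_spaceI N)
  interpret fin: finite_product_prob_space N I
    by unfold_locales (rule I)
  have PN: "PiM I N = PM" unfolding PM_def by (intro PiM_cong) (auto simp: N_def)
  have PMprob: "prob_space PM" unfolding PM_def by (rule prob_space_PiM) (rule M)
  interpret PM: prob_space PM by fact
  have times: "measure PM (Pi\<^sub>E I A) = (\<Prod>k\<in>I. measure (M k) (A k))"
    if "\<And>k. k \<in> I \<Longrightarrow> A k \<in> sets (M k)" for A
  proof -
    have "measure (PiM I N) (Pi\<^sub>E I A) = (\<Prod>k\<in>I. measure (N k) (A k))"
      by (rule fin.prob_times) (use that in \<open>auto simp: N_def\<close>)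
    also have "\<dots> = (\<Prod>k\<in>I. measure (M k) (A k))" by (intro prod.cong) (auto simp: N_def)
    finally show ?thesis by (simp only: PN)
  qed
  have cell: "cell k j \<in> sets (M k)" if "k \<in> I" for k j
  proof -
    have "cell k j = idx k -` {j} \<inter> space (M k)" by (auto simp: cell_def)
    then show ?thesis using measurable_sets[OF idx[OF that], of "{j}"] by simp
  qed
  have box: "box i \<in> sets PM" for i
    unfolding box_def PM_def using I cell by (intro sets_PiM_I_finite) auto
  have q_le: "q i \<le> p k (i k)" if "i \<in> Ind" "k \<in> I" for i k
  proof -
    have "i k \<in> J" using that by (auto simp: Ind_def)
    have "q i \<le> (\<Sum>i' | i' \<in> Ind \<and> i' k = i k. q i')"
      by (rule member_le_sum) (use that Ind q0 in \<open>auto simp: Ind_def\<close>)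
    then show ?thesis using q[OF that(2) \<open>i k \<in> J\<close>] by (simp add: p_def cell_def Ind_def)
  qed
  have p0: "0 \<le> p k j" for k j by (simp add: p_def)
  have t0: "0 \<le> t i" if "i \<in> Ind" for i
    using q0 that p0 by (auto simp: t_def Ind_def intro!: divide_nonneg_nonneg prod_nonneg)
  define \<pi> where "\<pi> = density PM (\<lambda>x. \<Sum>i\<in>Ind. ennreal (t i) * indicator (box i) x)"
  have sets\<pi>: "sets \<pi> = sets PM" by (simp add: \<pi>_def)
  have em: "emeasure \<pi> B = ennreal (\<Sum>i\<in>Ind. t i * measure PM (box i \<inter> B))" if B: "B \<in> sets PM" for B
  proof -
    have "emeasure \<pi> B = (\<integral>\<^sup>+x. (\<Sum>i\<in>Ind. ennreal (t i) * indicator (box i) x) * indicator B x \<partial>PM)"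
      unfolding \<pi>_def by (rule emeasure_density) (use box B in auto)
    also have "\<dots> = (\<integral>\<^sup>+x. (\<Sum>i\<in>Ind. ennreal (t i) * indicator (box i \<inter> B) x) \<partial>PM)"
      by (simp add: sum_distrib_right indicator_inter_arith mult.assoc)
    also have "\<dots> = (\<Sum>i\<in>Ind. \<integral>\<^sup>+x. ennreal (t i) * indicator (box i \<inter> B) x \<partial>PM)"
      by (rule nn_integral_sum) (use box B in measurable)
    also have "\<dots> = (\<Sum>i\<in>Ind. ennreal (t i * measure PM (box i \<inter> B)))"
    proof (rule sum.cong[OF refl])
      fix i assume i: "i \<in> Ind"
      have "(\<integral>\<^sup>+x. ennreal (t i) * indicator (box i \<inter> B) x \<partial>PM) = ennreal (t i) * emeasure PM (box i \<inter> B)"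
        by (rule nn_integral_cmult_indicator) (use box B in auto)
      then show "(\<integral>\<^sup>+x. ennreal (t i) * indicator (box i \<inter> B) x \<partial>PM) = ennreal (t i * measure PM (box i \<inter> B))"
        by (simp add: PM.emeasure_eq_measure ennreal_mult t0[OF i])
    qed
    also have "\<dots> = ennreal (\<Sum>i\<in>Ind. t i * measure PM (box i \<inter> B))"
      by (rule sum_ennreal) (use t0 in auto)
    finally show ?thesis .
  qed
  have meas_proj: "(\<lambda>x. x k) \<in> measurable \<pi> (M k)" if "k \<in> I" for k
    unfolding measurable_cong_sets[OF sets\<pi> refl] PM_def
    by (rule measurable_component_singleton[OF that])
  have space\<pi>: "space \<pi> = space PM" by (rule sets_eq_imp_space_eq[OF sets\<pi>])
  have marg: "distr \<pi> (M k) (\<lambda>x. x k) = M k" if k: "k \<in> I" for k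
  proof (rule measure_eqI)
    fix A assume "A \<in> sets (distr \<pi> (M k) (\<lambda>x. x k))"
    then have A: "A \<in> sets (M k)" by simp
    interpret Mk: prob_space "M k" by (rule M[OF k])
    define a where "a = (\<lambda>j. measure (M k) (cell k j \<inter> A))"
    have a_le: "a j \<le> p k j" for j
      unfolding a_def p_def by (rule Mk.finite_measure_mono) (use cell k in auto)
    let ?B = "(\<lambda>x. x k) -` A \<inter> space \<pi>"
    have B: "?B \<in> sets PM" using measurable_sets[OF meas_proj[OF k] A] sets\<pi> by simp
    \<comment> \<open>Restricting coordinate k to A turns \<open>box i\<close> into a box with one
      side cut down, so the product formula still applies: the mass is \<open>q i\<close> times the
      conditional probability of A in its cell.\<close>
    have weight: "t i * measure PM (box i \<inter> ?B) = q i * (a (i k) / p k (i k))" if i: "i \<in> Ind" for i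
    proof -
      let ?A = "\<lambda>l. if l = k then cell k (i k) \<inter> A else cell l (i l)"
      have "box i \<inter> ?B = Pi\<^sub>E I ?A"
        using k by (auto simp: box_def space\<pi> PM_def space_PiM PiE_iff cell_def split: if_splits)
      moreover have "measure PM (Pi\<^sub>E I ?A) = (\<Prod>l\<in>I. measure (M l) (?A l))"
        by (rule times) (use cell k A in auto)
      moreover have "\<dots> = a (i k) * (\<Prod>l\<in>I - {k}. measure (M l) (?A l))"
        using I k by (simp add: prod.remove[of I k] a_def)
      moreover have "(\<Prod>l\<in>I - {k}. measure (M l) (?A l)) = (\<Prod>l\<in>I - {k}. p l (i l))"
        by (rule prod.cong) (auto simp: p_def)
      ultimately have *: "measure PM (box i \<inter> ?B) = a (i k) * (\<Prod>l\<in>I - {k}. p l (i l))" by simp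
      have pr: "(\<Prod>l\<in>I. p l (i l)) = p k (i k) * (\<Prod>l\<in>I - {k}. p l (i l))"
        using I k by (simp add: prod.remove[of I k])
      show ?thesis
      proof (cases "\<exists>l\<in>I. p l (i l) = 0")
        case True
        then have "q i \<le> 0" using q_le[OF i] by metis
        then have "q i = 0" using q0 i by (auto simp: Ind_def intro: antisym)
        then show ?thesis by (simp add: t_def)
      next
        case False
        then have "(\<Prod>l\<in>I - {k}. p l (i l)) \<noteq> 0" using I by simp
        then show ?thesis by (simp add: * pr t_def)
      qed
    qed
    have "(\<Sum>i\<in>Ind. t i * measure PM (box i \<inter> ?B)) = (\<Sum>i\<in>Ind. q i * (a (i k) / p k (i k)))"
      using weight by (intro sum.cong) auto
    also have "\<dots> = (\<Sum>j\<in>J. \<Sum>i | i \<in> Ind \<and> i k = j. q i * (a (i k) / p k (i k)))"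
      by (rule sum.group[symmetric]) (use Ind J k in \<open>auto simp: Ind_def\<close>)
    also have "\<dots> = (\<Sum>j\<in>J. a j)"
    proof (rule sum.cong[OF refl])
      fix j assume j: "j \<in> J"
      have "(\<Sum>i | i \<in> Ind \<and> i k = j. q i * (a (i k) / p k (i k)))
          = (\<Sum>i | i \<in> Ind \<and> i k = j. q i * (a j / p k j))"
        by (rule sum.cong) auto
      also have "\<dots> = (\<Sum>i | i \<in> Ind \<and> i k = j. q i) * (a j / p k j)"
        by (simp only: sum_distrib_right)
      also have "\<dots> = p k j * (a j / p k j)"
        using q[OF k j] by (simp add: p_def cell_def Ind_def)
      also have "\<dots> = a j"
      \<comment> \<open>In a null cell the quotient is 0 by convention, and this is the right value
        since A has no mass there either.\<close>
      proof (cases "p k j = 0")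
        case True
        then have "a j = 0" using a_le[of j] by (simp add: a_def antisym)
        then show ?thesis by simp
      qed simp
      finally show "(\<Sum>i | i \<in> Ind \<and> i k = j. q i * (a (i k) / p k (i k))) = a j" .
    qed
    also have "\<dots> = measure (M k) (\<Union>j\<in>J. cell k j \<inter> A)"
      unfolding a_def
      by (rule Mk.finite_measure_finite_Union[symmetric])
        (use J cell k A in \<open>auto simp: disjoint_family_on_def cell_def\<close>)
    also have "(\<Union>j\<in>J. cell k j \<inter> A) = A"
      using sets.sets_into_space[OF A] idxJ[OF k] by (auto simp: cell_def)
    finally have "emeasure \<pi> ?B = ennreal (measure (M k) A)" using em[OF B] by simp
    then show "emeasure (distr \<pi> (M k) (\<lambda>x. x k)) A = emeasure (M k) A"
      by (simp add: emeasure_distr[OF meas_proj[OF k] A] Mk.emeasure_eq_measure)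
  qed simp
  have prob: "prob_space \<pi>"
  proof (rule prob_space_distrD)
    show "(\<lambda>x. x k0) \<in> measurable \<pi> (M k0)" by (rule meas_proj[OF k0])
    show "prob_space (distr \<pi> (M k0) (\<lambda>x. x k0))" using marg[OF k0] M[OF k0] by simp
  qed
  have boxes: "measure \<pi> {x \<in> space (PiM I M). \<forall>k\<in>I. idx k (x k) = i k} = q i" if i: "i \<in> Ind" for i
  proof -
    have "{x \<in> space (PiM I M). \<forall>k\<in>I. idx k (x k) = i k} = box i"
      by (auto simp: box_def cell_def space_PiM PiE_iff extensional_def)
    moreover have "t i' * measure PM (box i' \<inter> box i) = (if i' = i then q i else 0)" if i': "i' \<in> Ind" for i'
    proof (cases "i' = i")
      case True
      have "measure PM (box i) = (\<Prod>k\<in>I. p k (i k))"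
        unfolding box_def p_def by (rule times) (use cell in auto)
      moreover have "q i = 0" if z: "(\<Prod>k\<in>I. p k (i k)) = 0"
      proof -
        obtain k where "k \<in> I" "p k (i k) = 0"
          using prod_zero_iff[OF I(1), of "\<lambda>k. p k (i k)"] z by blast
        then show ?thesis using q_le[OF i, of k] q0[of i] i by (simp add: Ind_def)
      qed
      ultimately show ?thesis using True by (auto simp: t_def)
    next
      case False
      have "box i' \<inter> box i = {}"
      proof (rule ccontr)
        assume "box i' \<inter> box i \<noteq> {}"
        then obtain x where x: "x \<in> box i'" "x \<in> box i" by blast
        have "i' k = i k" if "k \<in> I" for k
          using PiE_mem[OF x(1)[unfolded box_def] that] PiE_mem[OF x(2)[unfolded box_def] that]
          by (simp add: cell_def)
        then have "i' = i" using i i' by (intro PiE_ext[of i' I "\<lambda>_. J"]) (auto simp: Ind_def)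
        then show False using False by simp
      qed
      then show ?thesis using False by simp
    qed
    then have "(\<Sum>i'\<in>Ind. t i' * measure PM (box i' \<inter> box i)) = q i"
      using Ind i by (simp add: sum.delta cong: sum.cong)
    ultimately show ?thesis
      using em[OF box[of i]] q0[of i] i by (simp add: measure_def Ind_def)
  qed
  show ?thesis
    using that[of \<pi>] sets\<pi> prob marg boxes by (simp add: PM_def Ind_def)
qed

lemma integral_finite_range:
  fixes u :: "'j \<Rightarrow> real"
  assumes M: "prob_space M" and J: "finite J"
    and g: "\<And>x. x \<in> space M \<Longrightarrow> g x \<in> J" "\<And>j. j \<in> J \<Longrightarrow> {x \<in> space M. g x = j} \<in> sets M"
  shows "integrable M (\<lambda>x. u (g x))"
    and "(\<integral>x. u (g x) \<partial>M) = (\<Sum>j\<in>J. measure M {x \<in> space M. g x = j} * u j)"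
proof -
  interpret prob_space M by fact
  let ?A = "\<lambda>j. {x \<in> space M. g x = j}"
  have eq: "u (g x) = (\<Sum>j\<in>J. u j * indicator (?A j) x)" if x: "x \<in> space M" for x
  proof -
    have "(\<Sum>j\<in>J. u j * indicator (?A j) x) = (\<Sum>j\<in>J. if j = g x then u j else 0)"
      using x by (intro sum.cong) (auto simp: indicator_def)
    then show ?thesis using J g(1)[OF x] by simp
  qed
  have int: "integrable M (\<lambda>x. u j * indicator (?A j) x)" if "j \<in> J" for j
    using g(2)[OF that] by (intro integrable_mult_right integrable_real_indicator) (auto simp: emeasure_eq_measure)
  have "integrable M (\<lambda>x. \<Sum>j\<in>J. u j * indicator (?A j) x)"
    by (rule Bochner_Integration.integrable_sum) (rule int)
  then show "integrable M (\<lambda>x. u (g x))"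
    by (rule Bochner_Integration.integrable_cong[THEN iffD1, rotated 2]) (simp_all add: eq)
  have "(\<integral>x. u (g x) \<partial>M) = (\<integral>x. (\<Sum>j\<in>J. u j * indicator (?A j) x) \<partial>M)"
    by (rule Bochner_Integration.integral_cong) (simp_all add: eq)
  also have "\<dots> = (\<Sum>j\<in>J. \<integral>x. u j * indicator (?A j) x \<partial>M)"
    by (rule Bochner_Integration.integral_sum) (rule int)
  also have "\<dots> = (\<Sum>j\<in>J. measure M (?A j) * u j)"
    using g(2) by (intro sum.cong) auto
  finally show "(\<integral>x. u (g x) \<partial>M) = (\<Sum>j\<in>J. measure M (?A j) * u j)" .
qed

text \<open>The penalty is a sum over coordinates, so the suprema decouple: near-maximizers chosen
  separately in each coordinate form one point y, at which the joint bound \<open>le\<close> is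
  applied. This is how a constraint on the sum of the v's passes to the sum of their
  envelopes.\<close>

lemma lipschitz_envelope_sum:
  fixes v :: "'k \<Rightarrow> 'a \<Rightarrow> real" and Y :: "'k \<Rightarrow> 'a set"
  assumes I: "finite I"
    and d: "\<And>k. k \<in> I \<Longrightarrow> Metric_space (Y k) (d k)"
    and v: "\<And>k. k \<in> I \<Longrightarrow> \<forall>y\<in>Y k. \<bar>v k y\<bar> \<le> B k" and L: "0 \<le> L"
    and f: "\<And>k x. f k x = (SUP y\<in>Y k. v k y - L * d k x y)"
    and x: "x \<in> Pi\<^sub>E I Y"
    and le: "\<And>y. y \<in> Pi\<^sub>E I Y \<Longrightarrow> (\<Sum>k\<in>I. v k (y k)) \<le> a + L * (\<Sum>k\<in>I. d k (x k) (y k))"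
  shows "(\<Sum>k\<in>I. f k (x k)) \<le> a"
proof (rule field_le_epsilon)
  fix e :: real assume e: "0 < e"
  \<comment> \<open>The tolerance is shared among the coordinates; adding 1 covers the case of an
    empty \<open>I\<close>.\<close>
  define s where "s = e / (real (card I) + 1)"
  have s: "0 < s" "real (card I) * s \<le> e" using e by (auto simp: s_def field_simps)
  have "\<exists>y. y \<in> Y k \<and> f k (x k) - s < v k y - L * d k (x k) y" if k: "k \<in> I" for k
  proof (rule ccontr)
    assume *: "\<not> ?thesis"
    have "f k (x k) \<le> f k (x k) - s"
      by (rule Metric_space.lipschitz_envelope(4)[OF d[OF k] v[OF k] L f])
        (use x k * in \<open>auto simp: not_less\<close>)
    then show False using s by simp
  qed
  then have "\<forall>k\<in>I. \<exists>y. y \<in> Y k \<and> f k (x k) - s < v k y - L * d k (x k) y" by blast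
  from bchoice[OF this] obtain y
    where y: "\<forall>k\<in>I. y k \<in> Y k \<and> f k (x k) - s < v k (y k) - L * d k (x k) (y k)" by blast
  have "(\<Sum>k\<in>I. f k (x k)) \<le> (\<Sum>k\<in>I. v k (y k) - L * d k (x k) (y k) + s)"
    using y by (intro sum_mono) (auto simp: algebra_simps less_imp_le)
  also have "\<dots> = (\<Sum>k\<in>I. v k (restrict y I k)) - L * (\<Sum>k\<in>I. d k (x k) (restrict y I k)) + real (card I) * s"
    by (simp add: sum.distrib sum_subtractf sum_distrib_left)
  also have "\<dots> \<le> a + real (card I) * s"
    using le[of "restrict y I"] y by simp
  finally show "(\<Sum>k\<in>I. f k (x k)) \<le> a + e" using s by linarith
qed

text \<open>Duality is stated as a pair with a small gap, since coupling and potentials then come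
  from the same finite problem. The discrete potentials are lifted to functions below
  \<open>c\<close> everywhere, and the discrete coupling is lifted to a measure for which
  \<open>c\<close> exceeds the discrete cost only slightly on average.\<close>

lemma kantorovich_near_optimal:
  fixes X :: "'k \<Rightarrow> 'a topology" and \<mu> :: "'k \<Rightarrow> 'a measure"
  assumes I: "finite I" "I \<noteq> {}"
    and X: "\<And>k. k \<in> I \<Longrightarrow> Polish_space (X k)"
    and \<mu>: "\<And>k. k \<in> I \<Longrightarrow> borel_prob (X k) (\<mu> k)"
    and c: "c \<in> Cb (product_topology X I)" and \<epsilon>: "0 < \<epsilon>"
  obtains \<pi> f where "borel_prob (product_topology X I) \<pi>"
    and "\<And>k. k \<in> I \<Longrightarrow> distr \<pi> (borel_of (X k)) (\<lambda>x. x k) = \<mu> k"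
    and "\<And>k. k \<in> I \<Longrightarrow> f k \<in> Cb (X k)"
    and "\<And>x. x \<in> topspace (product_topology X I) \<Longrightarrow> (\<Sum>k\<in>I. f k (x k)) \<le> c x"
    and "(\<integral>x. c x \<partial>\<pi>) \<le> (\<Sum>k\<in>I. \<integral>x. f k x \<partial>\<mu> k) + \<epsilon>"
proof -
  let ?P = "product_topology X I"
  define Tk where "Tk = (\<lambda>k. topspace (X k))"
  define T where "T = Pi\<^sub>E I Tk"
  have topP: "topspace ?P = T" by (simp add: T_def Tk_def)
  have pr: "prob_space (\<mu> k)" and sets\<mu>: "sets (\<mu> k) = sets (borel_of (X k))" if "k \<in> I" for k
    using \<mu>[OF that] by (auto simp: borel_prob_def)
  have space\<mu>: "space (\<mu> k) = Tk k" if "k \<in> I" for k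
    using sets_eq_imp_space_eq[OF sets\<mu>[OF that]] by (simp add: Tk_def)
  have "\<forall>k\<in>I. \<exists>d. Metric_space (Tk k) d \<and> X k = Metric_space.mtopology (Tk k) d"
  proof
    fix k assume "k \<in> I"
    then have "metrizable_space (X k)"
      using X[of k] completely_metrizable_imp_metrizable_space by (auto simp: Polish_space_def)
    then obtain M d where *: "Metric_space M d" "X k = Metric_space.mtopology M d"
      by (auto simp: metrizable_space_def)
    then have "M = Tk k" unfolding Tk_def by (simp add: Metric_space.topspace_mtopology)
    with * show "\<exists>d. Metric_space (Tk k) d \<and> X k = Metric_space.mtopology (Tk k) d" by blast
  qed
  from bchoice[OF this] obtain d
    where d: "\<And>k. k \<in> I \<Longrightarrow> Metric_space (Tk k) (d k)"
      and Xd: "\<And>k. k \<in> I \<Longrightarrow> X k = Metric_space.mtopology (Tk k) (d k)" by blast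
  obtain B where B: "0 \<le> B" "\<And>x. x \<in> T \<Longrightarrow> \<bar>c x\<bar> \<le> B"
    using Cb_bound[OF c] topP by metis
  define nI where "nI = real (card I)"
  have nI: "0 < nI" using I by (simp add: nI_def card_gt_0_iff)
  \<comment> \<open>Five portions of \<open>\<tau>\<close> are spent: two in comparing
    \<open>c\<close> with the discrete cost on the compact sets, two on the mass outside them, and
    one in the finite duality.\<close>
  define \<tau> where "\<tau> = \<epsilon> / 8"
  have \<tau>: "0 < \<tau>" using \<epsilon> by (simp add: \<tau>_def)
  \<comment> \<open>A union bound over \<open>nI\<close> coordinates, with the oscillation of
    \<open>c\<close> at most \<open>2 * B\<close>, has to cost at most \<open>2 * \<tau>\<close>.
    The denominator contains \<open>B + 1\<close> because \<open>B\<close> may be zero.\<close>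
  define \<kappa> where "\<kappa> = \<tau> / ((B + 1) * nI)"
  have \<kappa>: "0 < \<kappa>" using \<tau> B nI by (simp add: \<kappa>_def)
  have B\<kappa>: "2 * B * (nI * \<kappa>) \<le> 2 * \<tau>"
  proof -
    have "nI * \<kappa> = \<tau> / (B + 1)" using nI by (simp add: \<kappa>_def)
    then have "B * (nI * \<kappa>) = \<tau> * (B / (B + 1))" by simp
    also have "\<dots> \<le> \<tau> * 1" using \<tau> B by (intro mult_left_mono) (auto simp: field_simps)
    finally show ?thesis by simp
  qed
  have "\<forall>k\<in>I. \<exists>K. compactin (X k) K \<and> K \<in> sets (\<mu> k) \<and> measure (\<mu> k) (space (\<mu> k) - K) \<le> \<kappa>"
    using Polish_space_tight[OF X \<mu> \<kappa>] by metis
  from bchoice[OF this] obtain K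
    where K: "\<And>k. k \<in> I \<Longrightarrow> compactin (X k) (K k)" "\<And>k. k \<in> I \<Longrightarrow> K k \<in> sets (\<mu> k)"
      "\<And>k. k \<in> I \<Longrightarrow> measure (\<mu> k) (Tk k - K k) \<le> \<kappa>"
    using space\<mu> by auto
  have "\<exists>r>0. \<forall>x\<in>Pi\<^sub>E I K. \<forall>z\<in>T. (\<forall>k\<in>I. d k (x k) (z k) < r) \<longrightarrow> \<bar>c z - c x\<bar> < \<tau>"
  proof (rule product_uniform_near_compact[of I X d c K \<tau>])
    show "continuous_map ?P euclideanreal c" using c by (simp add: Cb_def)
    show "Metric_space (topspace (X k)) (d k)" if "k \<in> I" for k
      using d[OF that] unfolding Tk_def .
    show "X k = Metric_space.mtopology (topspace (X k)) (d k)" if "k \<in> I" for k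
      using Xd[OF that] unfolding Tk_def .
    fix r assume "0 < r" and near: "\<And>x z. x \<in> Pi\<^sub>E I K \<Longrightarrow> z \<in> topspace ?P \<Longrightarrow>
      (\<And>k. k \<in> I \<Longrightarrow> d k (x k) (z k) < r) \<Longrightarrow> \<bar>c z - c x\<bar> < \<tau>"
    show "\<exists>r>0. \<forall>x\<in>Pi\<^sub>E I K. \<forall>z\<in>T. (\<forall>k\<in>I. d k (x k) (z k) < r) \<longrightarrow> \<bar>c z - c x\<bar> < \<tau>"
      using near unfolding topP by (intro exI[of _ r] conjI \<open>0 < r\<close>) blast
  qed (fact I(1) K(1) \<tau>)+
  then obtain r where r: "0 < r" "\<forall>x\<in>Pi\<^sub>E I K. \<forall>z\<in>T. (\<forall>k\<in>I. d k (x k) (z k) < r) \<longrightarrow> \<bar>c z - c x\<bar> < \<tau>"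
    by blast
  \<comment> \<open>With this slope the penalty at distance r already makes up for the whole
    oscillation \<open>2 * B\<close> of \<open>c\<close>.\<close>
  define m where "m = 2 * B / r"
  have m: "0 \<le> m" "m * r = 2 * B" using B r by (auto simp: m_def)
  \<comment> \<open>Moving each coordinate by at most \<open>\<delta>\<close> changes the penalty by
    at most \<open>\<tau>\<close>; the 1 in the denominator covers \<open>m = 0\<close>.\<close>
  define \<delta> where "\<delta> = \<tau> / (m * nI + 1)"
  have mn: "0 \<le> m * nI" using m nI by simp
  have \<delta>: "0 < \<delta>" using \<tau> mn by (simp add: \<delta>_def)
  have m\<delta>: "m * (nI * \<delta>) \<le> \<tau>"
  proof -
    have "m * (nI * \<delta>) = \<tau> * (m * nI / (m * nI + 1))" by (simp add: \<delta>_def)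
    also have "\<dots> \<le> \<tau> * 1" using \<tau> mn by (intro mult_left_mono) (auto simp: field_simps)
    finally show ?thesis by simp
  qed
  have "\<forall>k\<in>I. \<exists>idx :: 'a \<Rightarrow> nat. idx \<in> measurable (borel_of (X k)) (count_space UNIV) \<and> finite (idx ` Tk k) \<and>
      (\<forall>x y. x \<in> K k \<longrightarrow> y \<in> Tk k \<longrightarrow> idx x = idx y \<longrightarrow> d k x y < \<delta>)"
  proof
    fix k assume k: "k \<in> I"
    interpret Metric_space "Tk k" "d k" by (rule d[OF k])
    have "compactin mtopology (K k)" using K(1)[OF k] Xd[OF k] by simp
    from compactin_small_cells[OF this \<delta>]
    obtain idx :: "'a \<Rightarrow> nat" where "idx \<in> measurable (borel_of mtopology) (count_space UNIV)"
      "finite (idx ` Tk k)" "\<And>x y. x \<in> K k \<Longrightarrow> y \<in> Tk k \<Longrightarrow> idx x = idx y \<Longrightarrow> d k x y < \<delta>"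
      by blast
    then show "\<exists>idx :: 'a \<Rightarrow> nat. idx \<in> measurable (borel_of (X k)) (count_space UNIV) \<and> finite (idx ` Tk k) \<and>
      (\<forall>x y. x \<in> K k \<longrightarrow> y \<in> Tk k \<longrightarrow> idx x = idx y \<longrightarrow> d k x y < \<delta>)"
      using Xd[OF k] by auto
  qed
  from bchoice[OF this] obtain idx :: "'k \<Rightarrow> 'a \<Rightarrow> nat" where
    idx: "\<And>k. k \<in> I \<Longrightarrow> idx k \<in> measurable (borel_of (X k)) (count_space UNIV)"
      "\<And>k. k \<in> I \<Longrightarrow> finite (idx k ` Tk k)"
      "\<And>k x y. k \<in> I \<Longrightarrow> x \<in> K k \<Longrightarrow> y \<in> Tk k \<Longrightarrow> idx k x = idx k y \<Longrightarrow> d k x y < \<delta>"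
    by blast
  \<comment> \<open>One index set serves all factors. An index not taken by \<open>idx k\<close> has
    an empty cell of measure zero, so a tuple attained by no point gets no mass, and the infimum
    over the empty set that defines \<open>C\<close> there is harmless.\<close>
  define J where "J = (\<Union>k\<in>I. idx k ` Tk k)"
  have J: "finite J" unfolding J_def using I idx(2) by blast
  have idxJ: "idx k x \<in> J" if "k \<in> I" "x \<in> Tk k" for k x using that by (auto simp: J_def)
  define Ind where "Ind = (I \<rightarrow>\<^sub>E J)"
  have Ind: "finite Ind" unfolding Ind_def using I J by (intro finite_PiE) auto
  define g where "g = (\<lambda>x. \<lambda>k\<in>I. idx k (x k))"
  have g: "g x \<in> Ind" if "x \<in> T" for x using that idxJ by (auto simp: g_def Ind_def T_def)
  define dd where "dd = (\<lambda>x y. \<Sum>k\<in>I. d k (x k) (y k))"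
  have d0: "0 \<le> d k s t" and dc: "d k s t = d k t s" if "k \<in> I" for k s t
    using Metric_space.nonneg[OF d[OF that]] Metric_space.commute[OF d[OF that]] by auto
  have dd0: "0 \<le> dd x y" for x y unfolding dd_def by (intro sum_nonneg d0)
  have dd_commute: "dd x y = dd y x" for x y unfolding dd_def by (intro sum.cong refl dc)
  have dd_triangle: "dd x z \<le> dd x y + dd y z" if "x \<in> T" "y \<in> T" "z \<in> T" for x y z
    unfolding dd_def sum.distrib[symmetric]
    using that by (intro sum_mono Metric_space.triangle[OF d]) (auto simp: T_def)
  have dd_ge: "d k (x k) (y k) \<le> dd x y" if "k \<in> I" for k x y
    unfolding dd_def using that I d0 by (intro member_le_sum) auto
  \<comment> \<open>Off the compact sets \<^term>\<open>K k\<close> nothing is known about the modulus of continuity of c.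
    Minimizing \<^term>\<open>c z + m * dd z y\<close> also over z makes the cost Lipschitz in y, so that step
    functions below it have Lipschitz majorants below c; on the K k this changes c only little.\<close>
  define CS where "CS = (\<lambda>i. {c z + m * dd z y | z y. z \<in> T \<and> y \<in> T \<and> g y = i})"
  define C where "C = (\<lambda>i. Inf (CS i))"
  have CS_low: "- B \<le> s" if sC: "s \<in> CS i" for s i
  proof -
    obtain z y where "s = c z + m * dd z y" "z \<in> T" using sC by (auto simp: CS_def)
    moreover have "0 \<le> m * dd z y" using m dd0 by simp
    ultimately show ?thesis using B(2)[of z] by linarith
  qed
  have C_le: "C (g y) \<le> c z + m * dd z y" if "z \<in> T" "y \<in> T" for z y
    unfolding C_def using that CS_low by (intro cInf_lower bdd_belowI[of _ "- B"]) (auto simp: CS_def)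
  have C_ge: "s \<le> C (g x)" if "x \<in> T" "\<And>z y. z \<in> T \<Longrightarrow> y \<in> T \<Longrightarrow> g y = g x \<Longrightarrow> s \<le> c z + m * dd z y" for s x
    unfolding C_def using that by (intro cInf_greatest) (auto simp: CS_def)
  \<comment> \<open>The number of coordinates outside their compact sets. Where it is at least 1,
    the crude bound \<open>2 * B\<close> on the difference of \<open>c\<close> and the discrete cost
    is paid by the term \<open>2 * B * bad x\<close>, whose integral depends only on the
    marginals.\<close>
  define bad where "bad = (\<lambda>x. \<Sum>k\<in>I. indicat_real (Tk k - K k) (x k))"
  have c_le: "c x \<le> C (g x) + 2 * \<tau> + 2 * B * bad x" if x: "x \<in> T" for x
  proof (cases "x \<in> Pi\<^sub>E I K")
    case True
    have "c x - 2 * \<tau> \<le> C (g x)"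
    proof (rule C_ge[OF x])
      fix z y assume z: "z \<in> T" and y: "y \<in> T" and gy: "g y = g x"
      \<comment> \<open>If z is close to x in every coordinate, uniform continuity near the compact
        box applies; otherwise the penalty exceeds the oscillation of \<open>c\<close>. Passing from
        x to a point y with the same cell indices then costs one more \<open>\<tau>\<close>.\<close>
      have "c x - \<tau> \<le> c z + m * dd x z"
      proof (cases "\<forall>k\<in>I. d k (x k) (z k) < r")
        case near: True
        have "0 \<le> m * dd x z" using m dd0 by simp
        then show ?thesis using r(2) True z near by fastforce
      next
        case False
        then obtain k where "k \<in> I" "r \<le> d k (x k) (z k)" by auto
        then have "r \<le> dd x z" using dd_ge[of k x z] by simp
        then have "m * r \<le> m * dd x z" using m by (intro mult_left_mono)
        then show ?thesis using m B(2)[OF x] B(2)[OF z] \<tau> by linarith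
      qed
      also have "m * dd x z \<le> m * (dd x y + dd y z)"
        using dd_triangle[OF x y z] m by (intro mult_left_mono)
      also have "\<dots> = m * dd x y + m * dd z y" by (simp add: distrib_left dd_commute)
      finally have 1: "c x - \<tau> \<le> c z + (m * dd x y + m * dd z y)" by simp
      have "dd x y \<le> (\<Sum>k\<in>I. \<delta>)"
        unfolding dd_def
      proof (rule sum_mono)
        fix k assume k: "k \<in> I"
        have "idx k (x k) = idx k (y k)" using fun_cong[OF gy, of k] k by (simp add: g_def)
        then show "d k (x k) (y k) \<le> \<delta>"
          using idx(3)[OF k, of "x k" "y k"] True y k by (auto simp: T_def intro: less_imp_le)
      qed
      then have "m * dd x y \<le> m * (nI * \<delta>)" using m by (intro mult_left_mono) (simp_all add: nI_def)
      then show "c x - 2 * \<tau> \<le> c z + m * dd z y" using 1 m\<delta> by linarith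
    qed
    moreover have "0 \<le> 2 * B * bad x" unfolding bad_def using B by (intro mult_nonneg_nonneg sum_nonneg) auto
    ultimately show ?thesis by linarith
  next
    case False
    then obtain k where k: "k \<in> I" "x k \<in> Tk k - K k" using x by (auto simp: T_def PiE_iff)
    have "indicat_real (Tk k - K k) (x k) \<le> bad x"
      unfolding bad_def using k I by (intro member_le_sum) auto
    then have "1 \<le> bad x" using k by simp
    then have "2 * B * 1 \<le> 2 * B * bad x" using B by (intro mult_left_mono) auto
    moreover have "- B \<le> C (g x)" by (rule C_ge[OF x]) (use CS_low in \<open>auto simp: CS_def\<close>)
    ultimately show ?thesis using B(2)[OF x] \<tau> by linarith
  qed
  define p where "p = (\<lambda>k j. measure (\<mu> k) {x \<in> space (\<mu> k). idx k x = j})"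
  have idx\<mu>: "idx k \<in> measurable (\<mu> k) (count_space UNIV)" if "k \<in> I" for k
    unfolding measurable_cong_sets[OF sets\<mu>[OF that] refl] by (rule idx(1)[OF that])
  have cell: "{x \<in> space (\<mu> k). idx k x = j} \<in> sets (\<mu> k)" if "k \<in> I" for k j
  proof -
    have "{x \<in> space (\<mu> k). idx k x = j} = idx k -` {j} \<inter> space (\<mu> k)" by auto
    then show ?thesis using measurable_sets[OF idx\<mu>[OF that], of "{j}"] by simp
  qed
  have int_idx: "integrable (\<mu> k) (\<lambda>x. u (idx k x))"
    "(\<integral>x. u (idx k x) \<partial>\<mu> k) = (\<Sum>j\<in>J. p k j * u j)" if "k \<in> I" for k and u :: "nat \<Rightarrow> real"
    unfolding p_def
    by (rule integral_finite_range[OF pr[OF that] J]; use that idxJ space\<mu> cell in simp)+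
  have p1: "(\<Sum>j\<in>J. p k j) = 1" if "k \<in> I" for k
    using int_idx(2)[OF that, of "\<lambda>_. 1"] prob_space.prob_space[OF pr[OF that]] by simp
  have p0: "0 \<le> p k j" for k j by (simp add: p_def)
  obtain q u where q: "\<And>i. i \<in> Ind \<Longrightarrow> 0 \<le> q i"
    "\<And>k j. k \<in> I \<Longrightarrow> j \<in> J \<Longrightarrow> (\<Sum>i | i \<in> Ind \<and> i k = j. q i) = p k j"
    and u: "\<And>i. i \<in> Ind \<Longrightarrow> (\<Sum>k\<in>I. u k (i k)) \<le> C i"
    and dual: "(\<Sum>i\<in>Ind. q i * C i) \<le> (\<Sum>k\<in>I. \<Sum>j\<in>J. p k j * u k j) + \<tau>"
  proof (rule finite_transport_duality[of I J p \<tau> C])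
    fix q u assume "\<And>i. i \<in> (I \<rightarrow>\<^sub>E J) \<Longrightarrow> 0 \<le> q i"
      "\<And>k j. k \<in> I \<Longrightarrow> j \<in> J \<Longrightarrow> (\<Sum>i | i \<in> (I \<rightarrow>\<^sub>E J) \<and> i k = j. q i) = p k j"
      "\<And>i. i \<in> (I \<rightarrow>\<^sub>E J) \<Longrightarrow> (\<Sum>k\<in>I. u k (i k)) \<le> C i"
      "(\<Sum>i\<in>(I \<rightarrow>\<^sub>E J). q i * C i) \<le> (\<Sum>k\<in>I. \<Sum>j\<in>J. p k j * u k j) + \<tau>"
    then show thesis using that unfolding Ind_def by blast
  qed (rule I J p0 p1 \<tau>; assumption?)+
  define v where "v = (\<lambda>k y. u k (idx k y))"
  define f where "f = (\<lambda>k x. SUP y\<in>Tk k. v k y - m * d k x y)"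
  have vB: "\<forall>y\<in>Tk k. \<bar>v k y\<bar> \<le> (\<Sum>j\<in>J. \<bar>u k j\<bar>)" if "k \<in> I" for k
    unfolding v_def using that idxJ J by (intro ballI member_le_sum[of _ J "\<lambda>j. \<bar>u k j\<bar>"]) auto
  have f_eq: "\<And>k x. f k x = (SUP y\<in>Tk k. v k y - m * d k x y)" by (simp add: f_def)
  have fCb: "f k \<in> Cb (X k)" if "k \<in> I" for k
    using Metric_space.lipschitz_envelope(1)[OF d[OF that] vB[OF that] m(1) f_eq] Xd[OF that] by simp
  have fv: "v k x \<le> f k x" if "k \<in> I" "x \<in> Tk k" for k x
    by (rule Metric_space.lipschitz_envelope(2)[OF d[OF that(1)] vB[OF that(1)] m(1) f_eq that(2)])
  \<comment> \<open>The envelopes have the same slope \<open>m\<close> as the penalty in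
    \<open>C\<close>. The discrete constraint at \<open>g y\<close> followed by \<open>C_le\<close>
    is therefore exactly the bound that \<open>lipschitz_envelope_sum\<close> asks for.\<close>
  have fc: "(\<Sum>k\<in>I. f k (x k)) \<le> c x" if x: "x \<in> T" for x
  proof (rule lipschitz_envelope_sum[OF I(1) d vB m(1) f_eq x[unfolded T_def]])
    fix y assume "y \<in> Pi\<^sub>E I Tk"
    then have y: "y \<in> T" by (simp add: T_def)
    have "(\<Sum>k\<in>I. v k (y k)) = (\<Sum>k\<in>I. u k (g y k))" by (simp add: v_def g_def)
    also have "\<dots> \<le> C (g y)" by (rule u[OF g[OF y]])
    also have "\<dots> \<le> c x + m * dd x y" by (rule C_le[OF x y])
    finally show "(\<Sum>k\<in>I. v k (y k)) \<le> c x + m * (\<Sum>k\<in>I. d k (x k) (y k))" by (simp add: dd_def)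
  qed
  \<comment> \<open>Passing from the step functions to their envelopes only increases the dual
    value.\<close>
  have dual_le: "(\<Sum>k\<in>I. \<Sum>j\<in>J. p k j * u k j) \<le> (\<Sum>k\<in>I. \<integral>x. f k x \<partial>\<mu> k)"
  proof (rule sum_mono)
    fix k assume k: "k \<in> I"
    have "(\<Sum>j\<in>J. p k j * u k j) = (\<integral>x. v k x \<partial>\<mu> k)" unfolding v_def int_idx(2)[OF k] ..
    also have "\<dots> \<le> (\<integral>x. f k x \<partial>\<mu> k)"
      by (rule integral_mono)
        (use k int_idx(1)[OF k] Cb_integrable[OF fCb \<mu>] fv space\<mu> in \<open>auto simp: v_def\<close>)
    finally show "(\<Sum>j\<in>J. p k j * u k j) \<le> (\<integral>x. f k x \<partial>\<mu> k)" .
  qed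
  obtain \<pi> where \<pi>: "sets \<pi> = sets (PiM I \<mu>)" "prob_space \<pi>"
    "\<And>k. k \<in> I \<Longrightarrow> distr \<pi> (\<mu> k) (\<lambda>x. x k) = \<mu> k"
    "\<And>i. i \<in> Ind \<Longrightarrow> measure \<pi> {x \<in> space (PiM I \<mu>). \<forall>k\<in>I. idx k (x k) = i k} = q i"
  proof (rule coupling_of_cells[of I J \<mu> idx q])
    show "idx k x \<in> J" if "k \<in> I" "x \<in> space (\<mu> k)" for k x
      using that idxJ space\<mu> by simp
    show "(\<Sum>i | i \<in> (I \<rightarrow>\<^sub>E J) \<and> i k = j. q i) = measure (\<mu> k) {x \<in> space (\<mu> k). idx k x = j}"
      if "k \<in> I" "j \<in> J" for k j
      using q(2)[OF that] by (simp add: Ind_def p_def)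
    show "0 \<le> q i" if "i \<in> (I \<rightarrow>\<^sub>E J)" for i
      using q(1)[of i] that by (simp add: Ind_def)
    fix \<pi> assume "sets \<pi> = sets (PiM I \<mu>)" "prob_space \<pi>"
      "\<And>k. k \<in> I \<Longrightarrow> distr \<pi> (\<mu> k) (\<lambda>x. x k) = \<mu> k"
      "\<And>i. i \<in> (I \<rightarrow>\<^sub>E J) \<Longrightarrow> measure \<pi> {x \<in> space (PiM I \<mu>). \<forall>k\<in>I. idx k (x k) = i k} = q i"
    then show thesis by (intro that[of \<pi>]) (simp_all add: Ind_def)
  qed (rule I J pr idx\<mu>; assumption?)+
  interpret \<pi>: prob_space \<pi> by fact
  have sets\<pi>: "sets \<pi> = sets (borel_of ?P)"
  proof -
    have "sets \<pi> = sets (PiM I (\<lambda>k. borel_of (X k)))"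
      unfolding \<pi>(1) by (rule sets_PiM_cong) (use sets\<mu> in auto)
    then show ?thesis using sets_PiM_borel_of[OF I(1) Polish_space_second_countable[OF X]] by simp
  qed
  have borel\<pi>: "borel_prob ?P \<pi>" using sets\<pi> \<pi>(2) by (simp add: borel_prob_def)
  have space\<pi>: "space \<pi> = T" using sets_eq_imp_space_eq[OF sets\<pi>] topP by simp
  have marg: "distr \<pi> (borel_of (X k)) (\<lambda>x. x k) = \<mu> k" if "k \<in> I" for k
    using \<pi>(3)[OF that] distr_cong[OF refl sets\<mu>[OF that] refl, of \<pi> "\<lambda>x. x k"] by simp
  have proj: "(\<lambda>x. x k) \<in> measurable \<pi> (\<mu> k)" if "k \<in> I" for k
    unfolding measurable_cong_sets[OF \<pi>(1) refl] by (rule measurable_component_singleton[OF that])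
  have gset: "{x \<in> space \<pi>. g x = i} = {x \<in> space (PiM I \<mu>). \<forall>k\<in>I. idx k (x k) = i k}" if "i \<in> Ind" for i
  proof -
    have "g x = i \<longleftrightarrow> (\<forall>k\<in>I. idx k (x k) = i k)" for x
      using that by (auto simp: g_def Ind_def PiE_iff extensional_def fun_eq_iff)
    then show ?thesis using sets_eq_imp_space_eq[OF \<pi>(1)] by simp
  qed
  have gcell: "{x \<in> space \<pi>. g x = i} \<in> sets \<pi>" if "i \<in> Ind" for i
  proof -
    have "(\<lambda>x. idx k (x k)) \<in> measurable \<pi> (count_space UNIV)" if "k \<in> I" for k
      by (rule measurable_compose[OF proj idx\<mu>]) (use that in auto)
    then have "{x \<in> space \<pi>. \<forall>k\<in>I. idx k (x k) = i k} \<in> sets \<pi>"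
      using I by (intro sets.sets_Collect_finite_All') (auto intro: measurable_sets_Collect)
    then show ?thesis using gset[OF that] sets_eq_imp_space_eq[OF \<pi>(1)] by simp
  qed
  have intC: "integrable \<pi> (\<lambda>x. C (g x))" "(\<integral>x. C (g x) \<partial>\<pi>) = (\<Sum>i\<in>Ind. q i * C i)"
    using integral_finite_range[OF \<pi>(2) Ind, of g C] g space\<pi> gcell gset \<pi>(4) by auto
  have ind: "integrable \<pi> (\<lambda>x. indicat_real (Tk k - K k) (x k))"
    "(\<integral>x. indicat_real (Tk k - K k) (x k) \<partial>\<pi>) \<le> \<kappa>" if k: "k \<in> I" for k
  proof -
    have A: "Tk k - K k \<in> sets (\<mu> k)" using sets.compl_sets[OF K(2)[OF k]] space\<mu>[OF k] by simp
    show "integrable \<pi> (\<lambda>x. indicat_real (Tk k - K k) (x k))"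
      by (rule \<pi>.integrable_const_bound[of _ 1])
        (use measurable_compose[OF proj[OF k] borel_measurable_indicator[OF A]] in \<open>auto simp: indicator_def\<close>)
    have "(\<integral>x. indicat_real (Tk k - K k) (x k) \<partial>\<pi>) = (\<integral>y. indicat_real (Tk k - K k) y \<partial>distr \<pi> (\<mu> k) (\<lambda>x. x k))"
      by (rule integral_distr[symmetric]) (use proj[OF k] A in auto)
    also have "\<dots> = measure (\<mu> k) (Tk k - K k)"
      using \<pi>(3)[OF k] A space\<mu>[OF k] by (simp add: Int_absorb2)
    finally show "(\<integral>x. indicat_real (Tk k - K k) (x k) \<partial>\<pi>) \<le> \<kappa>" using K(3)[OF k] by simp
  qed
  have bad_int: "integrable \<pi> bad" "(\<integral>x. bad x \<partial>\<pi>) \<le> nI * \<kappa>"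
  proof -
    show "integrable \<pi> bad" unfolding bad_def by (rule Bochner_Integration.integrable_sum) (rule ind(1))
    have "(\<integral>x. bad x \<partial>\<pi>) = (\<Sum>k\<in>I. \<integral>x. indicat_real (Tk k - K k) (x k) \<partial>\<pi>)"
      unfolding bad_def by (rule Bochner_Integration.integral_sum) (rule ind(1))
    also have "\<dots> \<le> (\<Sum>k\<in>I. \<kappa>)" by (rule sum_mono) (rule ind(2))
    finally show "(\<integral>x. bad x \<partial>\<pi>) \<le> nI * \<kappa>" by (simp add: nI_def)
  qed
  have "(\<integral>x. c x \<partial>\<pi>) \<le> (\<integral>x. C (g x) + 2 * \<tau> + 2 * B * bad x \<partial>\<pi>)"
    by (rule integral_mono) (use Cb_integrable[OF c borel\<pi>] intC bad_int c_le space\<pi> in auto)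
  also have "\<dots> = (\<Sum>i\<in>Ind. q i * C i) + 2 * \<tau> + 2 * B * (\<integral>x. bad x \<partial>\<pi>)"
    using intC bad_int(1) \<pi>.prob_space by simp
  also have "\<dots> \<le> (\<Sum>i\<in>Ind. q i * C i) + 2 * \<tau> + 2 * B * (nI * \<kappa>)"
    using bad_int(2) B by (intro add_left_mono mult_left_mono) auto
  also have "\<dots> \<le> (\<Sum>k\<in>I. \<integral>x. f k x \<partial>\<mu> k) + \<epsilon>"
    using dual dual_le B\<kappa> \<tau> \<epsilon> by (simp add: \<tau>_def)
  finally show ?thesis
    using that[of \<pi> f] borel\<pi> marg fCb fc topP by simp
qed

section \<open>Invariant couplings\<close>

lemma module_fun: "module (\<lambda>(r :: real) (f :: 'x \<Rightarrow> real) x. r * f x)"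
  by unfold_locales (auto simp: fun_eq_iff algebra_simps)

text \<open>It is enough to test the generators, because the integrable functions with integral zero
  form a subspace. Integrability has to be part of that subspace: the integral is additive only on
  integrable functions.\<close>

lemma W_inv_integral_zero_iff:
  assumes \<pi>: "borel_prob Y \<pi>" and act: "\<And>g. g \<in> S \<Longrightarrow> continuous_map Y Y (act g)"
  shows "(\<forall>w\<in>W_inv S Y act. (\<integral>x. w x \<partial>\<pi>) = 0) \<longleftrightarrow>
    (\<forall>g\<in>S. \<forall>h\<in>Cb Y. (\<integral>x. h (act g x) \<partial>\<pi>) = (\<integral>x. h x \<partial>\<pi>))"
proof -
  interpret module "\<lambda>(r :: real) (f :: 'a \<Rightarrow> real) x. r * f x" by (rule module_fun)
  let ?gen = "{(\<lambda>x. h (act g x) - h x) | g h. g \<in> S \<and> h \<in> Cb Y}"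
  have W: "W_inv S Y act = span ?gen" by (simp add: W_inv_def fun_span_def)
  have int: "integrable \<pi> h" "integrable \<pi> (\<lambda>x. h (act g x))" if "h \<in> Cb Y" "g \<in> S" for h g
    using Cb_integrable[OF that(1) \<pi>] Cb_integrable[OF Cb_compose[OF that(1) act[OF that(2)]] \<pi>] by auto
  show ?thesis
  proof (intro iffI ballI)
    fix g h assume 0: "\<forall>w\<in>W_inv S Y act. (\<integral>x. w x \<partial>\<pi>) = 0" and g: "g \<in> S" and h: "h \<in> Cb Y"
    have "(\<lambda>x. h (act g x) - h x) \<in> W_inv S Y act"
      unfolding W by (rule span_base) (use g h in blast)
    then have "(\<integral>x. h (act g x) - h x \<partial>\<pi>) = 0" using 0 by blast
    then show "(\<integral>x. h (act g x) \<partial>\<pi>) = (\<integral>x. h x \<partial>\<pi>)" using int[OF h g] by simp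
  next
    fix w assume inv: "\<forall>g\<in>S. \<forall>h\<in>Cb Y. (\<integral>x. h (act g x) \<partial>\<pi>) = (\<integral>x. h x \<partial>\<pi>)"
      and w: "w \<in> W_inv S Y act"
    have "span ?gen \<subseteq> {w. integrable \<pi> w \<and> (\<integral>x. w x \<partial>\<pi>) = 0}"
    proof (rule span_minimal)
      show "?gen \<subseteq> {w. integrable \<pi> w \<and> (\<integral>x. w x \<partial>\<pi>) = 0}"
        using int inv by auto
      show "subspace {w. integrable \<pi> w \<and> (\<integral>x. w x \<partial>\<pi>) = 0}"
        by (auto simp: subspace_def zero_fun_def plus_fun_def)
    qed
    then show "(\<integral>x. w x \<partial>\<pi>) = 0" using w W by blast
  qed
qed

lemma oplus_Cb:
  assumes "f \<in> F_tuples n X"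
  shows "oplus n f \<in> Cb (product_space n X)"
proof -
  have f: "(\<lambda>x. f k (x k)) \<in> Cb (product_space n X)" if "k \<in> {1..n}" for k
    by (rule Cb_compose[OF _ continuous_map_product_projection[OF that]])
      (use assms that in \<open>simp add: F_tuples_def\<close>)
  have "continuous_map (product_space n X) euclideanreal (oplus n f)"
    unfolding oplus_def by (rule continuous_map_sum) (use f in \<open>auto simp: Cb_def\<close>)
  moreover have "bounded (oplus n f ` topspace (product_space n X))"
  proof -
    have "\<exists>B. \<forall>x\<in>topspace (product_space n X). \<bar>f k (x k)\<bar> \<le> B" if "k \<in> {1..n}" for k
      using Cb_bound[OF f[OF that]] by metis
    then have "\<forall>k\<in>{1..n}. \<exists>B. \<forall>x\<in>topspace (product_space n X). \<bar>f k (x k)\<bar> \<le> B" by blast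
    from bchoice[OF this] obtain B
      where B: "\<forall>k\<in>{1..n}. \<forall>x\<in>topspace (product_space n X). \<bar>f k (x k)\<bar> \<le> B k" by blast
    have "\<bar>oplus n f x\<bar> \<le> (\<Sum>k=1..n. B k)" if "x \<in> topspace (product_space n X)" for x
      unfolding oplus_def using B that by (intro order_trans[OF sum_abs] sum_mono) blast
    then show ?thesis by (auto intro!: boundedI)
  qed
  ultimately show ?thesis by (simp add: Cb_def)
qed

lemma integral_oplus:
  assumes f: "f \<in> F_tuples n X" and \<pi>: "\<pi> \<in> couplings n X \<mu>"
    and \<mu>: "\<And>k. k \<in> {1..n} \<Longrightarrow> borel_prob (X k) (\<mu> k)"
  shows "(\<integral>x. oplus n f x \<partial>\<pi>) = (\<Sum>k=1..n. \<integral>x. f k x \<partial>\<mu> k)"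
proof -
  have b: "borel_prob (product_space n X) \<pi>" using \<pi> by (simp add: couplings_def)
  have fk: "f k \<in> Cb (X k)" if "k \<in> {1..n}" for k using f that by (simp add: F_tuples_def)
  have s: "sets \<pi> = sets (borel_of (product_space n X))" using b by (simp add: borel_prob_def)
  have "(\<integral>x. oplus n f x \<partial>\<pi>) = (\<Sum>k=1..n. \<integral>x. f k (x k) \<partial>\<pi>)"
    unfolding oplus_def
    by (intro Bochner_Integration.integral_sum Cb_integrable[OF _ b] Cb_compose[OF fk]
        continuous_map_product_projection)
  also have "\<dots> = (\<Sum>k=1..n. \<integral>x. f k x \<partial>\<mu> k)"
  proof (rule sum.cong[OF refl])
    fix k assume k: "k \<in> {1..n}"
    have "(\<lambda>x. x k) \<in> measurable \<pi> (borel_of (X k))"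
      unfolding measurable_cong_sets[OF s refl]
      by (intro continuous_map_measurable continuous_map_product_projection k)
    then have "(\<integral>x. f k (x k) \<partial>\<pi>) = (\<integral>x. f k x \<partial>distr \<pi> (borel_of (X k)) (\<lambda>x. x k))"
      by (rule integral_distr[symmetric]) (rule Cb_borel_measurable[OF fk[OF k]])
    also have "distr \<pi> (borel_of (X k)) (\<lambda>x. x k) = \<mu> k"
      using \<pi> k by (simp add: couplings_def)
    finally show "(\<integral>x. f k (x k) \<partial>\<pi>) = (\<integral>x. f k x \<partial>\<mu> k)" .
  qed
  finally show ?thesis .
qed

text \<open>The values are taken in \<open>ereal\<close>, where infima and suprema need no
  nonemptiness or boundedness conditions. The two equalities come from one cycle: the infimum is at
  most the first supremum, which is at most the second, which is at most the infimum.\<close>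

theorem theorem5p6:
  fixes n :: nat
    and X :: "nat \<Rightarrow> 'a topology"
    and G :: "('g, 'e) monoid_scheme"
    and T :: "'g topology"
    and a :: "nat \<Rightarrow> 'g \<Rightarrow> 'a \<Rightarrow> 'a"
    and \<mu> :: "nat \<Rightarrow> 'a measure"
    and \<eta> :: "'g measure"
    and c :: "(nat \<Rightarrow> 'a) \<Rightarrow> real"
  assumes "1 \<le> n"
    and "\<And>k. k \<in> {1..n} \<Longrightarrow> Polish_space (X k)"
    and "topological_group G T" and "compact_space T"
    and "\<And>k. k \<in> {1..n} \<Longrightarrow> group_action G (topspace (X k)) (a k)"
    and "\<And>k g. k \<in> {1..n} \<Longrightarrow> g \<in> carrier G \<Longrightarrow> continuous_map (X k) (X k) (a k g)"
    and "\<And>f x. f \<in> Cb (product_space n X) \<Longrightarrow> x \<in> topspace (product_space n X) \<Longrightarrow>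
           (\<lambda>g. f (diag_act n a g x)) \<in> borel_measurable (borel_of T)"
    and "Haar_prob G T \<eta>"
    and "\<And>k. k \<in> {1..n} \<Longrightarrow> borel_prob (X k) (\<mu> k)"
    and "\<And>k g. k \<in> {1..n} \<Longrightarrow> g \<in> carrier G \<Longrightarrow> distr (\<mu> k) (\<mu> k) (a k g) = \<mu> k"
    and "c \<in> Cb (product_space n X)"
  shows "(INF \<pi>\<in>W_couplings n X \<mu> (W_inv (carrier G) (product_space n X) (diag_act n a)).
            ereal (\<integral>x. c x \<partial>\<pi>))
         = (SUP f\<in>{f \<in> F_tuples n X. \<forall>x\<in>topspace (product_space n X).
                       oplus n f x \<le> avg \<eta> (diag_act n a) c x}.
              ereal (\<Sum>k=1..n. \<integral>x. f k x \<partial>\<mu> k))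
       \<and> (SUP f\<in>{f \<in> F_tuples n X. \<forall>x\<in>topspace (product_space n X).
                       oplus n f x \<le> avg \<eta> (diag_act n a) c x}.
              ereal (\<Sum>k=1..n. \<integral>x. f k x \<partial>\<mu> k))
         = (SUP f\<in>{f \<in> F_tuples n X. \<forall>x\<in>topspace (product_space n X).
                       avg \<eta> (diag_act n a) (oplus n f) x \<le> avg \<eta> (diag_act n a) c x}.
              ereal (\<Sum>k=1..n. \<integral>x. f k x \<partial>\<mu> k))"
proof -
  let ?P = "product_space n X"
  let ?act = "diag_act n a"
  let ?W = "W_couplings n X \<mu> (W_inv (carrier G) ?P ?act)"
  note Polish = assms(2) and action = assms(5) and cont = assms(6) and \<mu> = assms(9)
    and \<mu>_inv = assms(10) and c = assms(11)
  have metr: "metrizable_space (X k)" if "k \<in> {1..n}" for k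
    using Polish[OF that] completely_metrizable_imp_metrizable_space by (auto simp: Polish_space_def)
  have \<eta>: "prob_space \<eta>" "sets \<eta> = sets (borel_of T)"
    using assms(8) by (auto simp: Haar_prob_def borel_prob_def)
  have G: "group G" "topspace T = carrier G"
    "continuous_map (prod_topology T T) T (\<lambda>(x, y). x \<otimes>\<^bsub>G\<^esub> y)"
    using assms(3) by (auto simp: topological_group_def)
  have act_cont: "continuous_map ?P ?P (?act g)" if g: "g \<in> carrier G" for g
    unfolding continuous_map_componentwise
  proof (intro conjI ballI)
    show "?act g ` topspace ?P \<subseteq> extensional {1..n}" by (auto simp: diag_act_def)
    fix k assume k: "k \<in> {1..n}"
    have "continuous_map ?P (X k) (a k g \<circ> (\<lambda>x. x k))"
      by (rule continuous_map_compose[OF _ cont[OF k g]]) (rule continuous_map_product_projection[OF k])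
    then show "continuous_map ?P (X k) (\<lambda>x. ?act g x k)" using k by (simp add: diag_act_def o_def)
  qed
  have act_mult: "?act (g \<otimes>\<^bsub>G\<^esub> h) x = ?act g (?act h x)"
    if "g \<in> carrier G" "h \<in> carrier G" "x \<in> topspace ?P" for g h x
    using that group_action.composition_rule[OF action]
    by (auto simp: diag_act_def fun_eq_iff restrict_def PiE_iff)
  have left_cont: "continuous_map T T (\<lambda>h. g \<otimes>\<^bsub>G\<^esub> h)" if "g \<in> carrier G" for g
  proof -
    have "continuous_map T (prod_topology T T) (\<lambda>h. (g, h))"
      using that G(2) by (intro continuous_map_pairedI) auto
    from continuous_map_compose[OF this G(3)] show ?thesis by (simp add: o_def)
  qed
  interpret averaging_action ?P G \<eta> ?act
  proof (intro averaging_action.intro averaging_action_axioms.intro)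
    show "metrizable_space ?P" using metr by (simp add: metrizable_space_product_topology)
    show "separable_space ?P"
      by (intro second_countable_imp_separable_space second_countable_product_topology
          Polish_space_second_countable Polish) auto
    show "space \<eta> = carrier G" using sets_eq_imp_space_eq[OF \<eta>(2)] G(2) by simp
    show "(\<lambda>g. f (?act g x)) \<in> borel_measurable \<eta>" if "f \<in> Cb ?P" "x \<in> topspace ?P" for f x
      unfolding measurable_cong_sets[OF \<eta>(2) refl] by (rule assms(7)[OF that])
    show "(\<lambda>h. g \<otimes>\<^bsub>G\<^esub> h) \<in> measurable \<eta> \<eta>" if "g \<in> carrier G" for g
      unfolding measurable_cong_sets[OF \<eta>(2) \<eta>(2)]
      by (rule continuous_map_measurable[OF left_cont[OF that]])
    show "distr \<eta> \<eta> (\<lambda>h. g \<otimes>\<^bsub>G\<^esub> h) = \<eta>" if "g \<in> carrier G" for g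
      using assms(8) that by (simp add: Haar_prob_def)
  qed (rule \<eta> G act_cont act_mult; assumption)+
  have W_iff: "\<pi> \<in> ?W \<longleftrightarrow> \<pi> \<in> couplings n X \<mu> \<and>
      (\<forall>g\<in>carrier G. \<forall>h\<in>Cb ?P. (\<integral>x. h (?act g x) \<partial>\<pi>) = (\<integral>x. h x \<partial>\<pi>))" for \<pi>
    using W_inv_integral_zero_iff[OF _ act_cont, of \<pi> "carrier G"]
    by (auto simp: W_couplings_def couplings_def)
  have avg_W: "avg_measure \<pi> \<in> ?W" if \<pi>: "\<pi> \<in> couplings n X \<mu>" for \<pi>
  proof -
    have b: "borel_prob ?P \<pi>" and marg: "\<And>k. k \<in> {1..n} \<Longrightarrow> distr \<pi> (borel_of (X k)) (\<lambda>x. x k) = \<mu> k"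
      using \<pi> by (auto simp: couplings_def)
    have s: "sets \<pi> = sets (borel_of ?P)" using b by (simp add: borel_prob_def)
    have "distr (avg_measure \<pi>) (borel_of (X k)) (\<lambda>x. x k) = \<mu> k" if k: "k \<in> {1..n}" for k
    proof (rule distr_avg_measure[OF b])
      have proj: "(\<lambda>x. x k) \<in> measurable (borel_of ?P) (borel_of (X k))"
        by (intro continuous_map_measurable continuous_map_product_projection k)
      then show "(\<lambda>x. x k) \<in> measurable (borel_of ?P) (borel_of (X k))" .
      show \<mu>s: "sets (\<mu> k) = sets (borel_of (X k))" using \<mu>[OF k] by (simp add: borel_prob_def)
      fix g assume g: "g \<in> carrier G"
      have proj\<pi>: "(\<lambda>x. x k) \<in> measurable \<pi> (borel_of (X k))"
        unfolding measurable_cong_sets[OF s refl] by (rule proj)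
      \<comment> \<open>The projection to factor k turns the diagonal action into
        \<open>a k g\<close>, so the translate of \<open>\<pi>\<close> has as marginal the image of
        \<open>\<mu> k\<close>, which is \<open>\<mu> k\<close> by invariance.\<close>
      have "distr \<pi> (borel_of (X k)) (\<lambda>x. ?act g x k) = distr \<pi> (borel_of (X k)) (a k g \<circ> (\<lambda>x. x k))"
        using k by (intro distr_cong) (auto simp: diag_act_def)
      also have "\<dots> = distr (distr \<pi> (borel_of (X k)) (\<lambda>x. x k)) (borel_of (X k)) (a k g)"
        by (rule distr_distr[OF continuous_map_measurable[OF cont[OF k g]] proj\<pi>, symmetric])
      also have "\<dots> = distr (\<mu> k) (\<mu> k) (a k g)"
        unfolding marg[OF k] by (intro distr_cong) (simp_all add: \<mu>s)
      also have "\<dots> = \<mu> k" by (rule \<mu>_inv[OF k g])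
      finally show "distr \<pi> (borel_of (X k)) (\<lambda>x. ?act g x k) = \<mu> k" .
    qed
    then show ?thesis
      unfolding W_iff couplings_def
      using borel_prob_avg_measure[OF b] avg_measure_invariant[OF b] by simp
  qed
  let ?F1 = "{f \<in> F_tuples n X. \<forall>x\<in>topspace ?P. oplus n f x \<le> avg \<eta> ?act c x}"
  let ?F2 = "{f \<in> F_tuples n X. \<forall>x\<in>topspace ?P. avg \<eta> ?act (oplus n f) x \<le> avg \<eta> ?act c x}"
  let ?val = "\<lambda>f. ereal (\<Sum>k=1..n. \<integral>x. f k x \<partial>\<mu> k)"
  let ?inf = "INF \<pi>\<in>?W. ereal (\<integral>x. c x \<partial>\<pi>)"
  have "?F1 \<subseteq> ?F2"
  proof
    fix f assume f: "f \<in> ?F1"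
    have "avg \<eta> ?act (oplus n f) x \<le> avg \<eta> ?act c x" if x: "x \<in> topspace ?P" for x
      using avg_mono[OF oplus_Cb avg_Cb[OF c] _ x, of f] f avg_avg[OF c x] by simp
    then show "f \<in> ?F2" using f by simp
  qed
  then have 12: "(SUP f\<in>?F1. ?val f) \<le> (SUP f\<in>?F2. ?val f)" by (rule SUP_subset_mono) simp
  have 2: "(SUP f\<in>?F2. ?val f) \<le> ?inf"
  proof (intro SUP_least INF_greatest)
    fix f \<pi> assume f: "f \<in> ?F2" and \<pi>: "\<pi> \<in> ?W"
    then have F: "f \<in> F_tuples n X" and \<pi>c: "\<pi> \<in> couplings n X \<mu>"
      and inv: "\<And>g h. g \<in> carrier G \<Longrightarrow> h \<in> Cb ?P \<Longrightarrow> (\<integral>x. h (?act g x) \<partial>\<pi>) = (\<integral>x. h x \<partial>\<pi>)"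
      unfolding W_iff by auto
    have b: "borel_prob ?P \<pi>" using \<pi>c by (simp add: couplings_def)
    then have space: "space \<pi> = topspace ?P"
      using sets_eq_imp_space_eq[of \<pi> "borel_of ?P"] by (simp add: borel_prob_def)
    \<comment> \<open>Integration against an invariant coupling does not see the averaging. Used for
      both sides of the averaged constraint, this makes the last inequality of the cycle ordinary
      weak duality.\<close>
    have avg: "(\<integral>x. avg \<eta> ?act h x \<partial>\<pi>) = (\<integral>x. h x \<partial>\<pi>)" if "h \<in> Cb ?P" for h
      by (rule integral_avg_invariant[OF that b inv[OF _ that]])
    have "(\<Sum>k=1..n. \<integral>x. f k x \<partial>\<mu> k) = (\<integral>x. avg \<eta> ?act (oplus n f) x \<partial>\<pi>)"
      by (simp only: integral_oplus[OF F \<pi>c \<mu>] avg[OF oplus_Cb[OF F]])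
    also have "\<dots> \<le> (\<integral>x. avg \<eta> ?act c x \<partial>\<pi>)"
      by (rule integral_mono) (use f space Cb_integrable[OF avg_Cb b] oplus_Cb[OF F] c in auto)
    finally show "?val f \<le> ereal (\<integral>x. c x \<partial>\<pi>)" by (simp add: avg[OF c])
  qed
  have 0: "?inf \<le> (SUP f\<in>?F1. ?val f)"
  \<comment> \<open>The coupling that is nearly optimal for the averaged cost need not annihilate W;
    its average does, and has the same cost in terms of \<open>c\<close>.\<close>
  proof (rule ereal_le_epsilon2)
    fix \<epsilon> :: real assume \<epsilon>: "0 < \<epsilon>"
    show "?inf \<le> (SUP f\<in>?F1. ?val f) + ereal \<epsilon>"
    proof (rule kantorovich_near_optimal[of "{1..n}" X \<mu> "avg \<eta> ?act c" \<epsilon>])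
      show "avg \<eta> ?act c \<in> Cb ?P" by (rule avg_Cb[OF c])
      fix \<pi> f assume b: "borel_prob ?P \<pi>"
        and marg: "\<And>k. k \<in> {1..n} \<Longrightarrow> distr \<pi> (borel_of (X k)) (\<lambda>x. x k) = \<mu> k"
        and f: "\<And>k. k \<in> {1..n} \<Longrightarrow> f k \<in> Cb (X k)"
        and le: "\<And>x. x \<in> topspace ?P \<Longrightarrow> (\<Sum>k=1..n. f k (x k)) \<le> avg \<eta> ?act c x"
        and opt: "(\<integral>x. avg \<eta> ?act c x \<partial>\<pi>) \<le> (\<Sum>k=1..n. \<integral>x. f k x \<partial>\<mu> k) + \<epsilon>"
      have "avg_measure \<pi> \<in> ?W" using b marg by (intro avg_W) (simp add: couplings_def)
      then have "?inf \<le> ereal (\<integral>x. c x \<partial>avg_measure \<pi>)" by (rule INF_lower)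
      also have "\<dots> = ereal (\<integral>x. avg \<eta> ?act c x \<partial>\<pi>)" by (simp only: integral_avg_measure[OF b c])
      also have "\<dots> \<le> ?val f + ereal \<epsilon>" using opt by simp
      also have "\<dots> \<le> (SUP f\<in>?F1. ?val f) + ereal \<epsilon>"
        by (intro add_right_mono SUP_upper) (use f le in \<open>auto simp: F_tuples_def oplus_def\<close>)
      finally show ?thesis .
    qed (use assms(1) Polish \<mu> \<epsilon> in auto)
  qed
  show ?thesis
  proof (intro conjI antisym)
    show "(SUP f\<in>?F1. ?val f) \<le> ?inf" using 12 2 by (rule order.trans)
    show "(SUP f\<in>?F2. ?val f) \<le> (SUP f\<in>?F1. ?val f)" using 2 0 by (rule order.trans)
  qed (fact 0, fact 12)
qed

end
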